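(* Let $(W,S)$ be a Coxeter system with $S$ finite. (1) The language $\operatorname{Pref}_T\subseteq S^*$ of reduced words for reflection-prefixes is regular. (2) The language $\operatorname{Pal}$ of palindromic reduced words is $$\operatorname{Pal}=\{s_1\cdots s_k s_{k+1}s_k\cdots s_1\in S^*\mid s_1\cdots s_k s_{k+1}\in \operatorname{Pref}_T\}.$$ (3) The following Poincaré series is rational: $$\operatorname{Pref}_T(q)=\sum_{\mathbf w\in \operatorname{Pref}_T}q^{\ell(w)}=\sum_{k\ge 0}\operatorname{pal}_k q^k,$$ where $\operatorname{pal}_k$ is the number of palindromic reduced words of length $k$. (4) The Poincaré series $\operatorname{Pal}(q)=q\operatorname{Pref}_T(q^2)$ is rational.
   Context: $\ell$ is the length function of $(W,S)$ and $T=\bigcup_{w\in W}wSw^{-1}$ is the set of reflections; every reflection has odd length. $S^*$ is the free monoid on $S$; for a word $\mathbf w=s_1\cdots s_k\in S^*$, $w$ denotes its product in $W$. The word $\mathbf w$ is reduced if $\ell(w)=k$. A palindromic reduced word is a reduced word for a reflection that is equal to its own reversal. The right weak order is defined by $u\le_R w$ iff $\ell(w)=\ell(u)+\ell(u^{-1}w)$. For $t\in T$ with $\ell(t)=2k+1$, a $t$-prefix is an element $p\in W$ with $p\le_R t$ and $\ell(p)=k+1$. A reflection-prefix is an element that is a $t$-prefix for some $t\in T$. $\operatorname{Pref}_T$ is the set of all reduced words of all reflection-prefixes. For a subset $B\subseteq S^*$, its Poincaré series is $B(q)=\sum_{\mathbf w\in B}q^{\ell(w)}$; in particular $\operatorname{Pal}(q)=\sum_{\mathbf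 w\in\operatorname{Pal}}q^{\ell(w)}$. A formal power series in $q$ is rational if it is a quotient of two polynomials in $q$. A language is regular if it is recognized by a finite deterministic automaton.
   Formalization: The identities in (3), (4) fail as printed (A_2: Pref_T(q)=2q+2q^2 but sum pal_k q^k=2q+2q^3; Z/2: Pal(q)=q but q Pref_T(q^2)=q^3). Proved instead: Pref_T(q)=sum pal_{2k+1} q^{k+1} and q Pal(q)=Pref_T(q^2); rationality is proved as stated. *)

theory Defs
  imports
    "HOL-Algebra.Generated_Groups"
    "HOL-Computational_Algebra.Polynomial_FPS"
begin

text \<open>The free monoid on \<open>S\<close> is \<open>lists S\<close>; a word is a list, and its product in the
  group \<open>W\<close> is \<open>word_prod W\<close>.\<close>

definition word_prod :: "('a, 'b) monoid_scheme \<Rightarrow> 'a list \<Rightarrow> 'a" where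
  "word_prod W ws = foldr (\<otimes>\<^bsub>W\<^esub>) ws \<one>\<^bsub>W\<^esub>"

text \<open>A value \<open>m s t = 0\<close> stands for \<open>m(s,t) = \<infinity>\<close>, that is, no relation between \<open>s\<close> and \<open>t\<close>.\<close>

definition coxeter_matrix :: "'a set \<Rightarrow> ('a \<Rightarrow> 'a \<Rightarrow> nat) \<Rightarrow> bool" where
  "coxeter_matrix S m \<longleftrightarrow>
     (\<forall>s\<in>S. m s s = 1) \<and>
     (\<forall>s\<in>S. \<forall>t\<in>S. m s t = m t s) \<and>
     (\<forall>s\<in>S. \<forall>t\<in>S. s \<noteq> t \<longrightarrow> m s t \<noteq> 1)"

text \<open>The congruence on the free monoid generated by \<open>(s t)\<^sup>m\<^sup>(\<^sup>s\<^sup>,\<^sup>t\<^sup>) = 1\<close>.  Since \<open>s s = 1\<close> is among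
  the relations, each generator is its own inverse, so the quotient of \<open>lists S\<close> by this congruence
  is the group presented by generators \<open>S\<close> and these relations.  If \<open>m s t = 0\<close> the relator is the
  empty word.\<close>

inductive coxeter_cong :: "'a set \<Rightarrow> ('a \<Rightarrow> 'a \<Rightarrow> nat) \<Rightarrow> 'a list \<Rightarrow> 'a list \<Rightarrow> bool"
  for S :: "'a set" and m :: "'a \<Rightarrow> 'a \<Rightarrow> nat" where
  relator: "\<lbrakk>u \<in> lists S; v \<in> lists S; s \<in> S; t \<in> S\<rbrakk>
     \<Longrightarrow> coxeter_cong S m (u @ concat (replicate (m s t) [s, t]) @ v) (u @ v)"
| refl: "u \<in> lists S \<Longrightarrow> coxeter_cong S m u u"
| sym: "coxeter_cong S m u v \<Longrightarrow> coxeter_cong S m v u"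
| trans: "\<lbrakk>coxeter_cong S m u v; coxeter_cong S m v w\<rbrakk> \<Longrightarrow> coxeter_cong S m u w"

definition coxeter_system :: "('a, 'b) monoid_scheme \<Rightarrow> 'a set \<Rightarrow> bool" where
  "coxeter_system W S \<longleftrightarrow>
     group W \<and> S \<subseteq> carrier W \<and> generate W S = carrier W \<and>
     (\<exists>m. coxeter_matrix S m \<and>
        (\<forall>u\<in>lists S. \<forall>v\<in>lists S. word_prod W u = word_prod W v \<longleftrightarrow> coxeter_cong S m u v))"

definition cox_length :: "('a, 'b) monoid_scheme \<Rightarrow> 'a set \<Rightarrow> 'a \<Rightarrow> nat" where
  "cox_length W S w = (LEAST n. \<exists>ws\<in>lists S. length ws = n \<and> word_prod W ws = w)"

definition reduced_word :: "('a, 'b) monoid_scheme \<Rightarrow> 'a set \<Rightarrow> 'a list \<Rightarrow> bool" where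
  "reduced_word W S ws \<longleftrightarrow> ws \<in> lists S \<and> cox_length W S (word_prod W ws) = length ws"

definition reflections :: "('a, 'b) monoid_scheme \<Rightarrow> 'a set \<Rightarrow> 'a set" where
  "reflections W S = {w \<otimes>\<^bsub>W\<^esub> s \<otimes>\<^bsub>W\<^esub> inv\<^bsub>W\<^esub> w | w s. w \<in> carrier W \<and> s \<in> S}"

definition weak_le :: "('a, 'b) monoid_scheme \<Rightarrow> 'a set \<Rightarrow> 'a \<Rightarrow> 'a \<Rightarrow> bool" where
  "weak_le W S u w \<longleftrightarrow>
     cox_length W S w = cox_length W S u + cox_length W S (inv\<^bsub>W\<^esub> u \<otimes>\<^bsub>W\<^esub> w)"

definition t_prefix :: "('a, 'b) monoid_scheme \<Rightarrow> 'a set \<Rightarrow> 'a \<Rightarrow> 'a \<Rightarrow> bool" where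
  "t_prefix W S t p \<longleftrightarrow>
     p \<in> carrier W \<and> weak_le W S p t \<and>
     (\<exists>k. cox_length W S t = 2 * k + 1 \<and> cox_length W S p = k + 1)"

definition reflection_prefix :: "('a, 'b) monoid_scheme \<Rightarrow> 'a set \<Rightarrow> 'a \<Rightarrow> bool" where
  "reflection_prefix W S p \<longleftrightarrow> (\<exists>t\<in>reflections W S. t_prefix W S t p)"

definition Pref :: "('a, 'b) monoid_scheme \<Rightarrow> 'a set \<Rightarrow> 'a list set" where
  "Pref W S = {ws. reduced_word W S ws \<and> reflection_prefix W S (word_prod W ws)}"

definition Pal :: "('a, 'b) monoid_scheme \<Rightarrow> 'a set \<Rightarrow> 'a list set" where
  "Pal W S = {ws. reduced_word W S ws \<and> word_prod W ws \<in> reflections W S \<and> rev ws = ws}"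

definition pal :: "('a, 'b) monoid_scheme \<Rightarrow> 'a set \<Rightarrow> nat \<Rightarrow> nat" where
  "pal W S k = card {ws \<in> Pal W S. length ws = k}"

text \<open>The exponent of a word is the Coxeter length of its product.  For finite \<open>S\<close> and a set \<open>B\<close>
  of reduced words, all the sets whose cardinality is taken are finite.\<close>

definition poincare_series :: "('a, 'b) monoid_scheme \<Rightarrow> 'a set \<Rightarrow> 'a list set \<Rightarrow> rat fps" where
  "poincare_series W S B =
     Abs_fps (\<lambda>n. of_nat (card {ws \<in> B. cox_length W S (word_prod W ws) = n}))"

text \<open>Stated without division because \<open>/\<close> on formal power series is a genuine quotient only when
  the result is again a power series.\<close>

definition rational_fps :: "rat fps \<Rightarrow> bool" where
  "rational_fps f \<longleftrightarrow> (\<exists>P Q. Q \<noteq> 0 \<and> fps_of_poly Q * f = fps_of_poly P)"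

text \<open>Recognition by a finite deterministic automaton.  Taking the states to be natural numbers
  loses nothing, as any finite state set can be renamed.\<close>

definition regular_language :: "'a set \<Rightarrow> 'a list set \<Rightarrow> bool" where
  "regular_language A L \<longleftrightarrow>
     (\<exists>(Q :: nat set) q0 F \<delta>.
        finite Q \<and> q0 \<in> Q \<and> F \<subseteq> Q \<and> (\<forall>q\<in>Q. \<forall>a\<in>A. \<delta> q a \<in> Q) \<and>
        L = {ws \<in> lists A. foldl \<delta> q0 ws \<in> F})"

end

theory Submission
  imports Defs "HOL-Library.FuncSet" "HOL-Computational_Algebra.Formal_Laurent_Series"
begin

text \<open>
  If \<open>t\<close> is a reflection with reduced word \<open>s\<^sub>1 \<dots> s\<^sub>n\<close>, then the root of \<open>t\<close> is an inversion of \<open>t\<close>;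
  the letter at which it turns negative must be the middle one, and the second half of the word has
  the same product as the reversed first half.  Hence \<open>us @ [s]\<close> lies in \<open>Pref\<close> iff the palindrome
  \<open>us @ [s] @ rev us\<close> is reduced.  This condition depends only on the cone type
  \<open>{v. us @ v reduced}\<close>: if \<open>us\<close> and \<open>vs\<close> have the same cone type and \<open>us @ [s] @ rev us\<close> is
  reduced, then so is \<open>vs @ [s] @ rev us\<close>, then so is its reversal \<open>us @ [s] @ rev vs\<close>, and then so is
  \<open>vs @ [s] @ rev vs\<close>.  So regularity follows from the finiteness of the set of cone types.

  A cone type is determined by the elementary roots (those dominating no other positive root) among
  the inversions of \<open>us\<close>, so it suffices that there are finitely many elementary roots, which is the
  theorem of Brink and Howlett.  An elementary root is reached from a simple root by a chain of
  elementary roots of increasing depth, each step being a simple reflection \<open>s\<close> with form value in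
  \<open>(-1, 0)\<close>.  The form takes only finitely many values in \<open>(-1, 1)\<close> between roots and simple roots,
  because two such roots generate a finite dihedral group, which is conjugate into a finite
  parabolic subgroup.  In a long chain two roots therefore have the same values in \<open>(-1, 1)\<close> on the
  simple roots, while the coordinates at the other simple roots are frozen.  The difference of these
  two roots is then isotropic, so their form value is \<open>1\<close> and one of them dominates the other.

  Finally, the vectors counting the words of length \<open>n\<close> accepted from each state of an automaton
  satisfy a linear recurrence, so the generating function of a regular language is rational.
\<close>

subsection \<open>Regular languages and their generating functions\<close>

definition left_quotient :: "'a list set \<Rightarrow> 'a list \<Rightarrow> 'a list set" where
  "left_quotient L u = {v. u @ v \<in> L}"

lemma foldl_left_quotient:
  "foldl (\<lambda>X a. {v. a # v \<in> X}) (left_quotient L u) ws = left_quotient L (u @ ws)"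
proof (induction ws arbitrary: u)
  case (Cons a ws)
  have "{v. a # v \<in> left_quotient L u} = left_quotient L (u @ [a])" by (simp add: left_quotient_def)
  then show ?case using Cons[of "u @ [a]"] by simp
qed simp

text \<open>Myhill-Nerode: the left quotients are the states, reading \<open>a\<close> divides by
  \<open>a\<close>, and a state accepts iff it contains \<open>[]\<close>. The injection
  \<open>e\<close> renames the states as natural numbers, the state type that
  \<open>regular_language\<close> prescribes.\<close>

lemma regular_if_finite_left_quotients:
  assumes L: "L \<subseteq> lists A" and fin: "finite (range (left_quotient L))"
  shows "regular_language A L"
proof -
  let ?Q = "range (left_quotient L)" and ?step = "\<lambda>X a. {v. a # v \<in> X}"
  obtain e :: "'a list set \<Rightarrow> nat" where e: "inj_on e ?Q"
    using finite_imp_inj_to_nat_seg[OF fin] by blast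
  define d where "d = inv_into ?Q e"
  have de: "d (e X) = X" if "X \<in> ?Q" for X unfolding d_def using inv_into_f_f[OF e that] .
  define \<delta> where "\<delta> q a = e (?step (d q) a)" for q a
  have step: "?step X a \<in> ?Q" if X: "X \<in> ?Q" for X a
  proof -
    obtain u where "X = left_quotient L u" using X by blast
    then have "?step X a = left_quotient L (u @ [a])" by (simp add: left_quotient_def)
    then show ?thesis by blast
  qed
  have run: "foldl \<delta> (e X) ws = e (foldl ?step X ws)" if "X \<in> ?Q" for X ws
    using that
  proof (induction ws arbitrary: X)
    case (Cons a ws)
    then show ?case using step[OF Cons.prems, of a] by (simp add: \<delta>_def de)
  qed simp
  have accept: "foldl \<delta> (e (left_quotient L [])) ws \<in> e ` {X \<in> ?Q. [] \<in> X} \<longleftrightarrow> ws \<in> L" for ws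
  proof -
    have "foldl \<delta> (e (left_quotient L [])) ws = e (left_quotient L ws)"
      using run[of "left_quotient L []" ws] by (simp add: foldl_left_quotient)
    moreover have "e (left_quotient L ws) \<in> e ` {X \<in> ?Q. [] \<in> X} \<longleftrightarrow> [] \<in> left_quotient L ws"
      using e by (auto simp: inj_on_def)
    ultimately show ?thesis by (simp add: left_quotient_def)
  qed
  show ?thesis unfolding regular_language_def
  proof (intro exI conjI ballI)
    show "finite (e ` ?Q)" using fin by simp
    show "e (left_quotient L []) \<in> e ` ?Q" by simp
    show "e ` {X \<in> ?Q. [] \<in> X} \<subseteq> e ` ?Q" by blast
    show "\<delta> q a \<in> e ` ?Q" if "q \<in> e ` ?Q" for q a using that step de by (auto simp: \<delta>_def)
    show "L = {ws \<in> lists A. foldl \<delta> (e (left_quotient L [])) ws \<in> e ` {X \<in> ?Q. [] \<in> X}}"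
      using L accept by auto
  qed
qed

text \<open>Gaussian elimination, with \<open>Q\<close> indexing the equations and \<open>I\<close>
  the unknowns: a pivot \<open>x j q \<noteq> 0\<close> eliminates equation \<open>q\<close>
  together with unknown \<open>j\<close>.\<close>

lemma homogeneous_system_nontrivial_solution:
  fixes x :: "'i \<Rightarrow> 'q \<Rightarrow> 'f :: field"
  assumes "finite Q" "finite I" "card Q < card I"
  shows "\<exists>k. (\<exists>i\<in>I. k i \<noteq> 0) \<and> (\<forall>q\<in>Q. (\<Sum>i\<in>I. k i * x i q) = 0)"
  using assms
proof (induction Q arbitrary: I x rule: finite_induct)
  case empty
  then have "I \<noteq> {}" by auto
  then show ?case by (intro exI[of _ "\<lambda>_. 1"]) auto
next
  case (insert q Q)
  show ?case
  proof (cases "\<forall>i\<in>I. x i q = 0")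
    case True
    then show ?thesis using insert.IH[of I x] insert.prems insert.hyps by auto
  next
    case False
    then obtain j where j: "j \<in> I" "x j q \<noteq> 0" by blast
    define y where "y i p = x i p - x i q / x j q * x j p" for i p
    have "card Q < card (I - {j})" using insert.prems insert.hyps j by simp
    then obtain k where k: "\<exists>i\<in>I - {j}. k i \<noteq> 0" "\<forall>p\<in>Q. (\<Sum>i\<in>I - {j}. k i * y i p) = 0"
      using insert.IH[of "I - {j}" y] insert.prems by auto
    define c where "c = - (\<Sum>i\<in>I - {j}. k i * x i q) / x j q"
    let ?k = "k(j := c)"
    have split: "(\<Sum>i\<in>I. ?k i * x i p) = c * x j p + (\<Sum>i\<in>I - {j}. k i * x i p)" for p
      using insert.prems(1) j(1) by (subst sum.remove[of I j]) (auto intro!: sum.cong)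
    have "(\<Sum>i\<in>I. ?k i * x i p) = 0" if "p \<in> insert q Q" for p
    proof (cases "p = q")
      case True
      then show ?thesis unfolding split using j(2) by (simp add: c_def)
    next
      case False
      then have "0 = (\<Sum>i\<in>I - {j}. k i * y i p)" using k(2) that by auto
      also have "\<dots> = (\<Sum>i\<in>I - {j}. k i * x i p) - (\<Sum>i\<in>I - {j}. k i * x i q) * (x j p / x j q)"
        unfolding y_def sum_distrib_right sum_subtractf[symmetric]
        by (intro sum.cong) (auto simp: algebra_simps)
      also have "\<dots> = (\<Sum>i\<in>I. ?k i * x i p)" unfolding split by (simp add: c_def)
      finally show ?thesis by simp
    qed
    moreover have "\<exists>i\<in>I. ?k i \<noteq> 0" using k(1) by auto
    ultimately show ?thesis by blast
  qed
qed

text \<open>In the product of the series with the reversed characteristic polynomial, the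
  coefficient of degree \<open>n + d\<close> is the recurrence sum at \<open>n\<close>, so the
  product is a polynomial. A nonzero \<open>k j\<close> keeps the denominator nonzero.\<close>

lemma rational_if_recurrence:
  assumes k: "k j \<noteq> 0" "j \<le> d" and rec: "\<And>n. (\<Sum>i\<le>d. k i * f (n + i)) = 0"
  shows "rational_fps (Abs_fps f)"
proof -
  define Q where "Q = (\<Sum>i\<le>d. monom (k i) (d - i))"
  have coeff_Q: "coeff Q n = (if n \<le> d then k (d - n) else 0)" for n
  proof -
    have "coeff Q n = (\<Sum>i\<le>d. if d - i = n then k i else 0)" by (simp add: Q_def coeff_sum)
    also have "\<dots> = (\<Sum>i\<le>d. if i = d - n \<and> n \<le> d then k i else 0)" by (intro sum.cong) auto
    finally show ?thesis by (cases "n \<le> d") simp_all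
  qed
  have "Q \<noteq> 0" using coeff_Q[of "d - j"] k by auto
  define G where "G = fps_of_poly Q * Abs_fps f"
  have G: "fps_nth G (n + d) = 0" for n
  proof -
    have "fps_nth G (n + d) = (\<Sum>i\<in>{0..n + d}. coeff Q i * f (n + d - i))" by (simp add: G_def fps_mult_nth)
    also have "\<dots> = (\<Sum>i\<in>{0..d}. coeff Q i * f (n + d - i))"
      by (rule sum.mono_neutral_right) (auto simp: coeff_Q)
    also have "\<dots> = (\<Sum>i\<le>d. k i * f (n + i))"
      by (rule sum.reindex_bij_witness[of _ "\<lambda>i. d - i" "\<lambda>i. d - i"]) (auto simp: coeff_Q)
    finally show ?thesis using rec by simp
  qed
  have "G = fps_of_poly (\<Sum>n<d. monom (fps_nth G n) n)"
  proof (rule fps_ext)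
    fix n
    have "coeff (\<Sum>n<d. monom (fps_nth G n) n) n = (\<Sum>i<d. if i = n then fps_nth G i else 0)"
      by (simp add: coeff_sum)
    then show "fps_nth G n = fps_nth (fps_of_poly (\<Sum>n<d. monom (fps_nth G n) n)) n"
      using G[of "n - d"] by (cases "n < d") simp_all
  qed
  then show ?thesis using \<open>Q \<noteq> 0\<close> unfolding rational_fps_def G_def by blast
qed

lemma card_words_Suc:
  assumes "finite A"
  shows "card {ws \<in> lists A. length ws = Suc n \<and> P ws} = (\<Sum>a\<in>A. card {ws \<in> lists A. length ws = n \<and> P (a # ws)})"
proof -
  let ?B = "\<lambda>a. {ws \<in> lists A. length ws = n \<and> P (a # ws)}"
  have fin: "finite (?B a)" for a
    by (rule finite_subset[OF _ finite_lists_length_eq[OF assms, of n]]) auto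
  have "{ws \<in> lists A. length ws = Suc n \<and> P ws} = (\<Union>a\<in>A. (#) a ` ?B a)"
  proof (intro equalityI subsetI)
    fix ws assume "ws \<in> {ws \<in> lists A. length ws = Suc n \<and> P ws}"
    then show "ws \<in> (\<Union>a\<in>A. (#) a ` ?B a)" by (cases ws) auto
  qed auto
  also have "card \<dots> = (\<Sum>a\<in>A. card ((#) a ` ?B a))"
    using assms fin by (intro card_UN_disjoint) auto
  also have "\<dots> = (\<Sum>a\<in>A. card (?B a))" by (intro sum.cong card_image) auto
  finally show ?thesis .
qed

text \<open>The vectors \<open>c n\<close>, indexed by the states, count the words of length
  \<open>n\<close> accepted from each state. The \<open>card Q + 1\<close> vectors
  \<open>c 0, ..., c (card Q)\<close> are linearly dependent, and one more letter acts linearly, so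
  the same relation holds after every shift.\<close>

lemma rational_if_regular:
  assumes A: "finite A" and reg: "regular_language A L"
  shows "rational_fps (Abs_fps (\<lambda>n. of_nat (card {ws \<in> L. length ws = n})))"
proof -
  obtain Q :: "nat set" and q0 F \<delta> where Q: "finite Q" "q0 \<in> Q" "\<And>q a. q \<in> Q \<Longrightarrow> a \<in> A \<Longrightarrow> \<delta> q a \<in> Q"
    and L: "L = {ws \<in> lists A. foldl \<delta> q0 ws \<in> F}"
    using reg unfolding regular_language_def by blast
  define c :: "nat \<Rightarrow> nat \<Rightarrow> rat" where
    "c n q = of_nat (card {ws \<in> lists A. length ws = n \<and> foldl \<delta> q ws \<in> F})" for n q
  have c_Suc: "c (Suc n) q = (\<Sum>a\<in>A. c n (\<delta> q a))" for n q
    unfolding c_def card_words_Suc[OF A] by simp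
  let ?d = "card Q"
  obtain k where k: "\<exists>i\<in>{..?d}. k i \<noteq> 0" "\<forall>q\<in>Q. (\<Sum>i\<in>{..?d}. k i * c i q) = 0"
    using homogeneous_system_nontrivial_solution[OF Q(1), of "{..?d}" c] by auto
  have rec: "(\<Sum>i\<le>?d. k i * c (n + i) q) = 0" if "q \<in> Q" for n q
    using that
  proof (induction n arbitrary: q)
    case (Suc n)
    have "(\<Sum>i\<le>?d. k i * c (Suc n + i) q) = (\<Sum>i\<le>?d. \<Sum>a\<in>A. k i * c (n + i) (\<delta> q a))"
      by (simp add: c_Suc sum_distrib_left)
    also have "\<dots> = (\<Sum>a\<in>A. \<Sum>i\<le>?d. k i * c (n + i) (\<delta> q a))" by (rule sum.swap)
    also have "\<dots> = 0" using Suc Q(3) by simp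
    finally show ?case .
  qed (use k in simp)
  have "{ws \<in> L. length ws = n} = {ws \<in> lists A. length ws = n \<and> foldl \<delta> q0 ws \<in> F}" for n
    by (auto simp: L)
  then have "(\<lambda>n. of_nat (card {ws \<in> L. length ws = n})) = (\<lambda>n. c n q0)" by (simp add: c_def)
  then show ?thesis using rational_if_recurrence[of k _ ?d "\<lambda>n. c n q0"] k(1) rec[OF Q(2)] by auto
qed

text \<open>Substituting \<open>fps_X ^ 2\<close> into the numerator and denominator of
  \<open>f\<close> gives those of \<open>fps_X * g\<close>; the extra factor
  \<open>monom 1 1\<close> moves \<open>fps_X\<close> into the denominator.\<close>

lemma rational_if_X_times_eq_compose_square:
  assumes f: "rational_fps f" and g: "fps_X * g = fps_compose f (fps_X ^ 2)"
  shows "rational_fps g"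
proof -
  obtain P Q where PQ: "Q \<noteq> 0" "fps_of_poly Q * f = fps_of_poly P"
    using f by (auto simp: rational_fps_def)
  let ?M = "monom (1 :: rat) 2"
  have M: "fps_of_poly ?M = fps_X ^ 2" by (rule fps_of_poly_monom')
  have poly: "fps_of_poly (pcompose R ?M) = fps_compose (fps_of_poly R) (fps_X ^ 2)" for R
    using fps_of_poly_pcompose[of ?M R] M by simp
  have "fps_of_poly (pcompose Q ?M * monom 1 1) * g = fps_of_poly (pcompose Q ?M) * (fps_X * g)"
    by (simp add: fps_of_poly_mult fps_of_poly_monom' mult.assoc)
  also have "\<dots> = fps_compose (fps_of_poly Q * f) (fps_X ^ 2)"
    unfolding g poly by (rule fps_compose_mult_distrib[symmetric]) simp
  also have "\<dots> = fps_of_poly (pcompose P ?M)" by (simp add: PQ poly)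
  finally have "fps_of_poly (pcompose Q ?M * monom 1 1) * g = fps_of_poly (pcompose P ?M)" .
  moreover have "pcompose Q ?M * monom 1 1 \<noteq> 0"
    using PQ(1) by (simp add: pcompose_eq_0_iff degree_monom_eq monom_eq_0_iff)
  ultimately show ?thesis unfolding rational_fps_def by blast
qed

subsection \<open>The geometric representation\<close>

text \<open>\<open>D\<close> is the dihedral group generated by \<open>a\<close> and
  \<open>b\<close>, listed as the powers of \<open>a \<otimes> b\<close> and these powers times
  \<open>a\<close>. Closure under right multiplication will make a sum over \<open>D\<close>
  invariant.\<close>

lemma (in group) finite_right_closed_dihedral:
  assumes a: "a \<in> carrier G" and b: "b \<in> carrier G" and aa: "a \<otimes> a = \<one>" and bb: "b \<otimes> b = \<one>"
    and k: "0 < k" "(a \<otimes> b) [^] (k::nat) = \<one>"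
  shows "\<exists>D \<subseteq> carrier G. finite D \<and> D \<noteq> {} \<and> (\<forall>d\<in>D. d \<otimes> a \<in> D \<and> d \<otimes> b \<in> D)"
proof -
  let ?r = "a \<otimes> b"
  have r: "?r \<in> carrier G" using a b by simp
  define D where "D = (\<lambda>j::nat. ?r [^] j) ` UNIV \<union> (\<lambda>j::nat. ?r [^] j \<otimes> a) ` UNIV"
  have pow_mod: "?r [^] j = ?r [^] (j mod k)" for j
  proof -
    have "?r [^] j = ?r [^] (k * (j div k) + j mod k)" by simp
    also have "\<dots> = (?r [^] k) [^] (j div k) \<otimes> ?r [^] (j mod k)"
      using r by (simp only: nat_pow_mult nat_pow_pow nat_pow_closed)
    finally show ?thesis using k r by simp
  qed
  have "D \<subseteq> (\<lambda>j::nat. ?r [^] j) ` {..<k} \<union> (\<lambda>j::nat. ?r [^] j \<otimes> a) ` {..<k}"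
  proof -
    have "?r [^] j \<in> (\<lambda>j::nat. ?r [^] j) ` {..<k}" "?r [^] j \<otimes> a \<in> (\<lambda>j::nat. ?r [^] j \<otimes> a) ` {..<k}" for j :: nat
      using pow_mod[of j] k(1) by (auto intro!: image_eqI[of _ _ "j mod k"])
    then show ?thesis unfolding D_def by blast
  qed
  then have fin: "finite D" by (rule finite_subset) simp
  have 1: "?r [^] j \<otimes> a \<otimes> a = ?r [^] j" for j :: nat using r a aa by (simp add: m_assoc)
  have 2: "?r [^] j \<otimes> a \<otimes> b = ?r [^] (Suc j)" for j :: nat using r a b by (simp add: m_assoc)
  \<comment> \<open>Multiplying a rotation by \<open>b\<close> lowers its exponent by one and
    appends \<open>a\<close>; the exponent \<open>j + (k - 1)\<close> is \<open>j - 1\<close> modulo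
    \<open>k\<close>, which covers \<open>j = 0\<close>.\<close>
  have 3: "?r [^] j \<otimes> b = ?r [^] (j + (k - 1)) \<otimes> a" for j :: nat
  proof -
    have "?r [^] j = ?r [^] (j + k)" using pow_mod[of j] pow_mod[of "j + k"] by simp
    also have "\<dots> = ?r [^] (Suc (j + (k - 1)))" using k(1) by simp
    also have "\<dots> = ?r [^] (j + (k - 1)) \<otimes> a \<otimes> b" by (rule 2[symmetric])
    finally show ?thesis using r a b bb by (simp add: m_assoc)
  qed
  have in_D: "?r [^] j \<in> D" "?r [^] j \<otimes> a \<in> D" for j :: nat by (auto simp: D_def)
  have "d \<otimes> a \<in> D \<and> d \<otimes> b \<in> D" if d: "d \<in> D" for d
  proof -
    obtain j :: nat where "d = ?r [^] j \<or> d = ?r [^] j \<otimes> a" using d unfolding D_def by blast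
    then show ?thesis using in_D 1[of j] 2[of j] 3[of j] by metis
  qed
  then show ?thesis using fin r a by (intro exI[of _ D]) (auto simp: D_def)
qed

text \<open>The Coxeter matrix, existentially quantified in \<open>coxeter_system\<close>, becomes a
  parameter here, so that the bilinear form can depend on it.\<close>

locale coxeter = group W for W :: "('a, 'b) monoid_scheme" (structure) +
  fixes S :: "'a set" and m :: "'a \<Rightarrow> 'a \<Rightarrow> nat"
  assumes S_carrier: "S \<subseteq> carrier W"
    and generate_S: "generate W S = carrier W"
    and finite_S: "finite S"
    and coxeter_matrix: "coxeter_matrix S m"
    and word_prod_eq_iff: "\<And>u v. u \<in> lists S \<Longrightarrow> v \<in> lists S \<Longrightarrow>
      word_prod W u = word_prod W v \<longleftrightarrow> coxeter_cong S m u v"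
begin

text \<open>Otherwise \<open>auto\<close> would expand \<open>ws \<in> lists S\<close> into a statement about \<open>set ws\<close>.\<close>

declare in_listsD [rule del] in_listsI [rule del]

text \<open>Gram matrix of the simple roots for the standard form of the geometric representation.
  The value \<open>- 1\<close> for \<open>m s t = 0\<close>, which encodes infinity, is the limit of
  \<open>- cos (pi / n)\<close>.\<close>

definition form_coeff :: "'a \<Rightarrow> 'a \<Rightarrow> real" where
  "form_coeff s t = (if m s t = 0 then - 1 else - cos (pi / m s t))"

definition bil :: "('a \<Rightarrow> real) \<Rightarrow> ('a \<Rightarrow> real) \<Rightarrow> real" where
  "bil u v = (\<Sum>s\<in>S. \<Sum>t\<in>S. u s * v t * form_coeff s t)"

definition simple :: "'a \<Rightarrow> 'a \<Rightarrow> real" where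
  "simple s = (\<lambda>t. if t = s then 1 else 0)"

definition reflect :: "('a \<Rightarrow> real) \<Rightarrow> ('a \<Rightarrow> real) \<Rightarrow> 'a \<Rightarrow> real" where
  "reflect u v = (\<lambda>t. v t - 2 * bil u v * u t)"

definition act :: "'a list \<Rightarrow> ('a \<Rightarrow> real) \<Rightarrow> 'a \<Rightarrow> real" where
  "act ws = foldr (\<lambda>s. reflect (simple s)) ws"

lemma m_diag: "s \<in> S \<Longrightarrow> m s s = 1"
  and m_sym: "s \<in> S \<Longrightarrow> t \<in> S \<Longrightarrow> m s t = m t s"
  and m_off_diag: "s \<in> S \<Longrightarrow> t \<in> S \<Longrightarrow> s \<noteq> t \<Longrightarrow> m s t \<noteq> 1"
  using coxeter_matrix unfolding coxeter_matrix_def by blast+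

lemma form_coeff_sym: "s \<in> S \<Longrightarrow> t \<in> S \<Longrightarrow> form_coeff s t = form_coeff t s"
  by (simp add: form_coeff_def m_sym)

lemma bil_sym: "bil u v = bil v u"
proof -
  have "bil u v = (\<Sum>t\<in>S. \<Sum>s\<in>S. u s * v t * form_coeff s t)"
    unfolding bil_def by (rule sum.swap)
  also have "\<dots> = bil v u"
    unfolding bil_def by (rule sum.cong[OF HOL.refl], rule sum.cong[OF HOL.refl]) (metis form_coeff_sym mult.commute)
  finally show ?thesis .
qed

lemma bil_comb_right: "bil u (\<lambda>x. a * v x + c * w x) = a * bil u v + c * bil u w"
  unfolding bil_def by (simp add: sum_distrib_left sum.distrib[symmetric] algebra_simps)

lemma bil_comb_left: "bil (\<lambda>x. a * v x + c * w x) u = a * bil v u + c * bil w u"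
  by (metis bil_comb_right bil_sym)

lemma bil_minus_right: "bil u (\<lambda>x. - v x) = - bil u v"
  using bil_comb_right[of u "- 1" v 0 v] by simp

lemma bil_minus_left: "bil (\<lambda>x. - v x) u = - bil v u"
  by (metis bil_minus_right bil_sym)

lemma bil_reflect_right: "bil u (reflect v w) = bil u w - 2 * bil v w * bil u v"
  using bil_comb_right[of u 1 w "- 2 * bil v w" v] unfolding reflect_def by simp

lemma bil_reflect: "bil u u = 1 \<Longrightarrow> bil (reflect u v) (reflect u w) = bil v w"
  by (simp add: bil_reflect_right bil_sym[of "reflect u v"] bil_sym[of w] bil_sym[of u v] algebra_simps)

lemma reflect_comb:
  "reflect u (\<lambda>x. a * v x + c * w x) = (\<lambda>x. a * reflect u v x + c * reflect u w x)"
  unfolding reflect_def by (simp add: bil_comb_right fun_eq_iff algebra_simps)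

lemma reflect_reflect: "bil u u = 1 \<Longrightarrow> reflect u (reflect u v) = v"
  unfolding reflect_def[of u "reflect u v"] bil_reflect_right by (rule ext) (simp add: reflect_def)

lemma reflect_minus_left: "reflect (\<lambda>x. - u x) = reflect u"
  by (intro ext) (simp add: reflect_def bil_minus_left)

lemma bil_simple_left: "s \<in> S \<Longrightarrow> bil (simple s) v = (\<Sum>t\<in>S. v t * form_coeff s t)"
proof -
  assume s: "s \<in> S"
  have "bil (simple s) v = (\<Sum>r\<in>S. if r = s then (\<Sum>t\<in>S. v t * form_coeff s t) else 0)"
    unfolding bil_def by (rule sum.cong[OF HOL.refl]) (simp add: simple_def)
  also have "\<dots> = (\<Sum>t\<in>S. v t * form_coeff s t)" using s finite_S by simp
  finally show ?thesis .
qed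

lemma bil_expand: "bil u v = (\<Sum>s\<in>S. u s * bil (simple s) v)"
  unfolding bil_def[of u]
  by (rule sum.cong[OF HOL.refl]) (simp add: bil_simple_left sum_distrib_left mult_ac)

lemma bil_simple: "s \<in> S \<Longrightarrow> t \<in> S \<Longrightarrow> bil (simple s) (simple t) = form_coeff s t"
proof -
  assume s: "s \<in> S" and t: "t \<in> S"
  have "bil (simple s) (simple t) = (\<Sum>r\<in>S. if r = t then form_coeff s t else 0)"
    unfolding bil_simple_left[OF s] by (rule sum.cong[OF HOL.refl]) (simp add: simple_def)
  also have "\<dots> = form_coeff s t" using t finite_S by simp
  finally show ?thesis .
qed

lemma form_coeff_diag: "s \<in> S \<Longrightarrow> form_coeff s s = 1"
  by (simp add: form_coeff_def m_diag)

lemma bil_simple_self: "s \<in> S \<Longrightarrow> bil (simple s) (simple s) = 1"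
  by (simp add: bil_simple form_coeff_diag)

lemma cos_pi_div_nonneg: "2 \<le> (k::nat) \<Longrightarrow> 0 \<le> cos (pi / k)"
proof -
  assume "2 \<le> k"
  then have "pi / k \<le> pi / 2" by (intro divide_left_mono) auto
  then show ?thesis by (intro cos_ge_zero) (auto intro: order_trans[of _ 0])
qed

lemma form_coeff_off_diag: "s \<in> S \<Longrightarrow> t \<in> S \<Longrightarrow> s \<noteq> t \<Longrightarrow> form_coeff s t \<le> 0"
proof -
  assume "s \<in> S" "t \<in> S" "s \<noteq> t"
  then have "m s t \<noteq> 1" by (rule m_off_diag)
  then have "m s t = 0 \<or> 2 \<le> m s t" by linarith
  then show ?thesis using cos_pi_div_nonneg[of "m s t"] by (auto simp: form_coeff_def)
qed

lemma act_simps [simp]: "act [] = id" "act (s # ws) = reflect (simple s) \<circ> act ws"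
  by (simp_all add: act_def)

lemma act_append: "act (us @ vs) = act us \<circ> act vs"
  by (induction us) auto

lemma act_comb: "act ws (\<lambda>x. a * v x + c * w x) = (\<lambda>x. a * act ws v x + c * act ws w x)"
  by (induction ws) (auto simp: reflect_comb)

lemma bil_act: "ws \<in> lists S \<Longrightarrow> bil (act ws u) (act ws v) = bil u v"
  by (induction ws) (auto simp: bil_reflect bil_simple_self)

lemma reflect_off: "t \<notin> S \<Longrightarrow> s \<in> S \<Longrightarrow> reflect (simple s) v t = v t"
  by (auto simp: reflect_def simple_def)

lemma act_off: "ws \<in> lists S \<Longrightarrow> t \<notin> S \<Longrightarrow> act ws v t = v t"
  by (induction ws) (auto simp: reflect_off)

lemma act_concat_replicate:
  "act (concat (replicate n [s, t])) = (reflect (simple s) \<circ> reflect (simple t)) ^^ n"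
  by (induction n) (simp_all add: act_append comp_assoc)

text \<open>For unit vectors with form value \<open>- cos \<theta>\<close> the product of the two
  reflections rotates their plane by \<open>2 * \<theta>\<close>; this is the closed form of its
  powers. It covers vectors \<open>x\<close> outside the plane too, so that a power can be
  recognized as the identity on the whole space.\<close>

lemma rotation_formula:
  assumes uu: "bil u u = 1" and vv: "bil v v = 1" and uv: "bil u v = - cos \<theta>" and s: "sin \<theta> \<noteq> 0"
  shows "((reflect u \<circ> reflect v) ^^ k) x z = x z -
    2 * sin (k * \<theta>) / (sin \<theta>)\<^sup>2 *
      ((bil v x * sin (k * \<theta>) + bil u x * sin (k * \<theta> - \<theta>)) * v z +
       (bil v x * sin (k * \<theta> + \<theta>) + bil u x * sin (k * \<theta>)) * u z)"
proof (induction k arbitrary: x)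
  case 0
  show ?case by simp
next
  case (Suc k)
  \<comment> \<open>With these abbreviations the induction step is a polynomial identity modulo
    \<open>a * a + c * c = 1\<close> and \<open>A * A + C * C = 1\<close>.\<close>
  define a c A C where "a = sin \<theta>" and "c = cos \<theta>" and "A = sin (k * \<theta>)" and "C = cos (k * \<theta>)"
  have ac: "c * c = 1 - a * a" using sin_cos_squared_add[of \<theta>] by (simp add: a_def c_def power2_eq_square algebra_simps)
  have AC: "C * C = 1 - A * A" using sin_cos_squared_add[of "k * \<theta>"] by (simp add: A_def C_def power2_eq_square algebra_simps)
  have vu: "bil v u = - c" using uv bil_sym by (simp add: c_def)
  have uv': "bil u v = - c" using uv by (simp add: c_def)
  define X Y where "X = bil u x" and "Y = bil v x"
  let ?x = "reflect u (reflect v x)"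
  have x1: "bil u (reflect v x) = X + 2 * c * Y"
    by (simp add: bil_reflect_right X_def Y_def uv')
  have bu: "bil u ?x = - (X + 2 * c * Y)"
    using x1 by (simp add: bil_reflect_right[of u u] uu)
  have bv: "bil v ?x = - Y + 2 * c * (X + 2 * c * Y)"
    using x1 by (simp add: bil_reflect_right[of v u] bil_reflect_right[of v v] vu vv Y_def)
  have xz: "?x z = x z - 2 * Y * v z - 2 * (X + 2 * c * Y) * u z"
    using x1 by (simp add: reflect_def[of u] reflect_def[of v] Y_def)
  have e1: "sin (k * \<theta> - \<theta>) = A * c - C * a" "sin (k * \<theta> + \<theta>) = A * c + C * a"
    by (simp_all add: sin_diff sin_add A_def C_def a_def c_def)
  have e2: "Suc k * \<theta> = k * \<theta> + \<theta>" by (simp add: algebra_simps)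
  have e3: "sin (k * \<theta> + \<theta> + \<theta>) = (A * c + C * a) * c + (C * c - A * a) * a"
    unfolding sin_add[of "k * \<theta> + \<theta>"] e1 by (simp add: cos_add A_def C_def a_def c_def)
  have e4: "sin (k * \<theta> + \<theta> - \<theta>) = A" by (simp add: A_def)
  have step: "((reflect u \<circ> reflect v) ^^ Suc k) x z = ((reflect u \<circ> reflect v) ^^ k) ?x z"
    by (simp add: funpow_swap1)
  have a0: "a \<noteq> 0" using s by (simp add: a_def)
  let ?p = "A * c + C * a"
  have LHS: "a * a * ((reflect u \<circ> reflect v) ^^ Suc k) x z = a * a * (x z - 2 * Y * v z - 2 * (X + 2 * c * Y) * u z) -
      2 * A * (((- Y + 2 * c * (X + 2 * c * Y)) * A - (X + 2 * c * Y) * (A * c - C * a)) * v z +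
        ((- Y + 2 * c * (X + 2 * c * Y)) * ?p - (X + 2 * c * Y) * A) * u z)"
    unfolding step Suc bu bv xz e1 A_def[symmetric] a_def[symmetric]
    using a0 by (simp add: field_simps power2_eq_square)
  \<comment> \<open>After clearing the denominator \<open>a * a\<close>, the equations
    \<open>k1\<close> to \<open>k4\<close> compare the coefficients of \<open>Y * v z\<close>,
    \<open>X * v z\<close>, \<open>Y * u z\<close> and \<open>X * u z\<close>.\<close>
  have k1: "a * a + A * ((4 * c * c - 1) * A - 2 * c * (A * c - C * a)) = ?p * ?p"
    using ac AC by algebra
  have k2: "A * (2 * c * A - (A * c - C * a)) = ?p * A"
    by algebra
  have k3: "2 * c * a * a + A * ((4 * c * c - 1) * ?p - 2 * c * A) = ?p * (?p * c + (C * c - A * a) * a)"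
    using ac AC by algebra
  have k4: "a * a + A * (2 * c * ?p - A) = ?p * ?p"
    using ac AC by algebra
  have "a * a * ((reflect u \<circ> reflect v) ^^ Suc k) x z = a * a * x z -
      2 * (Y * (a * a + A * ((4 * c * c - 1) * A - 2 * c * (A * c - C * a))) + X * (A * (2 * c * A - (A * c - C * a)))) * v z
      - 2 * (Y * (2 * c * a * a + A * ((4 * c * c - 1) * ?p - 2 * c * A)) + X * (a * a + A * (2 * c * ?p - A))) * u z"
    unfolding LHS by algebra
  also have "\<dots> = a * a * x z - 2 * ?p * ((Y * ?p + X * A) * v z + (Y * (?p * c + (C * c - A * a) * a) + X * ?p) * u z)"
    unfolding k1 k2 k3 k4 by algebra
  finally have "((reflect u \<circ> reflect v) ^^ Suc k) x z = x z -
     2 * ?p / (a * a) * ((Y * ?p + X * A) * v z + (Y * (?p * c + (C * c - A * a) * a) + X * ?p) * u z)"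
    using a0 by (simp add: field_simps)
  then show ?case
    unfolding e2 e3 e1 A_def[symmetric] a_def[symmetric] X_def[symmetric] Y_def[symmetric]
    by (simp only: power2_eq_square e4)
qed

lemma rotation_trivial:
  assumes "bil u u = 1" "bil v v = 1" "bil u v = - cos \<theta>" "sin \<theta> \<noteq> 0" "sin (real k * \<theta>) = 0"
  shows "(reflect u \<circ> reflect v) ^^ k = id"
  using rotation_formula[OF assms(1-4)] assms(5) by (intro ext) simp

lemma act_relator:
  assumes s: "s \<in> S" and t: "t \<in> S"
  shows "act (concat (replicate (m s t) [s, t])) = id"
proof (cases "m s t = 0")
  case True
  then show ?thesis by simp
next
  case False
  show ?thesis
  proof (cases "s = t")
    case True
    then show ?thesis using s
      by (simp add: m_diag fun_eq_iff reflect_reflect bil_simple_self)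
  next
    case ne: False
    then have m2: "2 \<le> m s t" using m_off_diag[OF s t ne] False by linarith
    have "sin (pi / m s t) > 0"
      using m2 by (intro sin_gt_zero) (auto simp: field_simps)
    then show ?thesis unfolding act_concat_replicate using m2
      by (intro rotation_trivial[of _ _ "pi / m s t"])
         (auto simp: bil_simple_self s t bil_simple form_coeff_def)
  qed
qed

lemma coxeter_cong_act: "coxeter_cong S m u v \<Longrightarrow> act u = act v"
  by (induction rule: coxeter_cong.induct) (auto simp: act_append act_relator)

text \<open>Every relator has even length \<open>2 * m s t\<close>, so the parity of the length is
  an invariant: the sign character of the group.\<close>

lemma coxeter_cong_parity: "coxeter_cong S m u v \<Longrightarrow> even (length u) \<longleftrightarrow> even (length v)"
proof (induction rule: coxeter_cong.induct)
  case (relator u v s t)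
  have "length (concat (replicate n [s, t])) = 2 * n" for n by (induction n) auto
  then show ?case by simp
qed auto

section \<open>Words and length in the group\<close>

abbreviation len :: "'a \<Rightarrow> nat" where "len \<equiv> cox_length W S"
abbreviation val :: "'a list \<Rightarrow> 'a" where "val \<equiv> word_prod W"

lemma gen_closed [simp]: "s \<in> S \<Longrightarrow> s \<in> carrier W"
  using S_carrier by blast

lemma val_simps [simp]: "val [] = \<one>" "val (s # ws) = s \<otimes> val ws"
  by (simp_all add: word_prod_def)

lemma val_closed [simp]: "ws \<in> lists S \<Longrightarrow> val ws \<in> carrier W"
  by (induction ws) auto

lemma val_append: "us \<in> lists S \<Longrightarrow> vs \<in> lists S \<Longrightarrow> val (us @ vs) = val us \<otimes> val vs"
  by (induction us) (auto simp: m_assoc)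

lemma gen_square [simp]: "s \<in> S \<Longrightarrow> s \<otimes> s = \<one>"
proof -
  assume s: "s \<in> S"
  have "coxeter_cong S m ([] @ concat (replicate (m s s) [s, s]) @ []) ([] @ [])"
    using s by (intro coxeter_cong.relator) auto
  then have "coxeter_cong S m [s, s] []" using s by (simp add: m_diag)
  then have "val [s, s] = val []" using word_prod_eq_iff[of "[s, s]" "[]"] s by auto
  then show ?thesis using s by simp
qed

lemma gen_inv [simp]: "s \<in> S \<Longrightarrow> inv s = s"
  by (simp add: inv_equality)

lemma gen_cancel_right [simp]: "s \<in> S \<Longrightarrow> w \<in> carrier W \<Longrightarrow> w \<otimes> s \<otimes> s = w"
  by (simp add: m_assoc)

lemma gen_cancel_left [simp]: "s \<in> S \<Longrightarrow> w \<in> carrier W \<Longrightarrow> s \<otimes> (s \<otimes> w) = w"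
  by (simp add: m_assoc[symmetric])

lemma rev_lists [simp]: "rev ws \<in> lists S \<longleftrightarrow> ws \<in> lists S"
  by (simp add: in_lists_conv_set)

lemma val_rev: "ws \<in> lists S \<Longrightarrow> val (rev ws) = inv (val ws)"
  by (induction ws) (auto simp: val_append inv_mult_group)

lemma ex_word: "w \<in> carrier W \<Longrightarrow> \<exists>ws\<in>lists S. val ws = w"
proof -
  assume "w \<in> carrier W"
  then have "w \<in> generate W S" by (simp add: generate_S)
  then show ?thesis
  proof (induction rule: generate.induct)
    case one
    show ?case by (rule bexI[of _ "[]"]) auto
  next
    case (incl h)
    then show ?case by (intro bexI[of _ "[h]"]) auto
  next
    case (inv h)
    then show ?case by (intro bexI[of _ "[h]"]) auto
  next
    case (eng h1 h2)
    then obtain u v where "u \<in> lists S" "val u = h1" "v \<in> lists S" "val v = h2" by auto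
    then show ?case by (intro bexI[of _ "u @ v"]) (auto simp: val_append)
  qed
qed

lemma ex_reduced: "w \<in> carrier W \<Longrightarrow> \<exists>ws\<in>lists S. length ws = len w \<and> val ws = w"
proof -
  assume "w \<in> carrier W"
  then obtain ws where "ws \<in> lists S" "val ws = w" using ex_word by blast
  then show ?thesis unfolding cox_length_def
    by (intro LeastI_ex[of "\<lambda>n. \<exists>ws\<in>lists S. length ws = n \<and> val ws = w"]) auto
qed

lemma len_val_le: "ws \<in> lists S \<Longrightarrow> len (val ws) \<le> length ws"
  unfolding cox_length_def by (rule Least_le) auto

lemma len_one [simp]: "len \<one> = 0"
  using len_val_le[of "[]"] by simp

lemma len_zero: "w \<in> carrier W \<Longrightarrow> len w = 0 \<Longrightarrow> w = \<one>"
  using ex_reduced[of w] by auto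

lemma len_mult_le: "u \<in> carrier W \<Longrightarrow> v \<in> carrier W \<Longrightarrow> len (u \<otimes> v) \<le> len u + len v"
proof -
  assume u: "u \<in> carrier W" and v: "v \<in> carrier W"
  obtain us where us: "us \<in> lists S" "length us = len u" "val us = u" using ex_reduced[OF u] by auto
  obtain vs where vs: "vs \<in> lists S" "length vs = len v" "val vs = v" using ex_reduced[OF v] by auto
  have "len (val (us @ vs)) \<le> length (us @ vs)" using us vs by (intro len_val_le) auto
  then show ?thesis using us vs by (simp add: val_append)
qed

lemma len_inv [simp]: "w \<in> carrier W \<Longrightarrow> len (inv w) = len w"
proof -
  have le: "len (inv w) \<le> len w" if wc: "w \<in> carrier W" for w
  proof -
    obtain ws where ws: "ws \<in> lists S" "length ws = len w" "val ws = w" using ex_reduced[OF wc] by auto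
    then have "len (val (rev ws)) \<le> length (rev ws)" by (intro len_val_le) auto
    then show ?thesis using ws by (simp add: val_rev)
  qed
  assume w: "w \<in> carrier W"
  show ?thesis using le[OF w] le[of "inv w"] w by simp
qed

lemma parity_len: "ws \<in> lists S \<Longrightarrow> even (len (val ws)) \<longleftrightarrow> even (length ws)"
proof -
  assume ws: "ws \<in> lists S"
  obtain us where us: "us \<in> lists S" "length us = len (val ws)" "val us = val ws"
    using ex_reduced[of "val ws"] ws by auto
  then have "coxeter_cong S m us ws" using word_prod_eq_iff ws by blast
  then show ?thesis using coxeter_cong_parity us by metis
qed

lemma parity_len_mult:
  assumes u: "u \<in> carrier W" and v: "v \<in> carrier W"
  shows "even (len (u \<otimes> v)) \<longleftrightarrow> even (len u + len v)"
proof -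
  obtain us where us: "us \<in> lists S" "length us = len u" "val us = u" using ex_reduced[OF u] by auto
  obtain vs where vs: "vs \<in> lists S" "length vs = len v" "val vs = v" using ex_reduced[OF v] by auto
  have "even (len (val (us @ vs))) \<longleftrightarrow> even (length (us @ vs))" using us vs by (intro parity_len) auto
  then show ?thesis using us vs by (simp add: val_append)
qed

lemma len_gen: "s \<in> S \<Longrightarrow> len s = 1"
proof -
  assume s: "s \<in> S"
  have "len s \<le> 1" using len_val_le[of "[s]"] s by simp
  moreover have "odd (len s)" using parity_len[of "[s]"] s by simp
  ultimately show ?thesis by (cases "len s") auto
qed

text \<open>Multiplying by a generator changes the length by at most one, and it changes the
  parity.\<close>

lemma len_mult_gen:
  assumes w: "w \<in> carrier W" and s: "s \<in> S"
  shows "len (w \<otimes> s) = Suc (len w) \<or> len w = Suc (len (w \<otimes> s))"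
proof -
  have "len (w \<otimes> s) \<le> len w + 1" using len_mult_le[of w s] len_gen[OF s] w s by simp
  moreover have "len w \<le> len (w \<otimes> s) + 1" using len_mult_le[of "w \<otimes> s" s] len_gen[OF s] w s by simp
  moreover have "even (len (w \<otimes> s)) \<longleftrightarrow> odd (len w)"
    using parity_len_mult[of w s] len_gen[OF s] w s by simp
  ultimately show ?thesis by presburger
qed

lemma reduced_word_lists: "reduced_word W S ws \<Longrightarrow> ws \<in> lists S"
  by (simp add: reduced_word_def)

lemma reduced_wordD: "reduced_word W S ws \<Longrightarrow> len (val ws) = length ws"
  by (simp add: reduced_word_def)

lemma ex_reduced_word: "w \<in> carrier W \<Longrightarrow> \<exists>ws. reduced_word W S ws \<and> val ws = w"
  using ex_reduced[of w] unfolding reduced_word_def by metis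

lemma reduced_word_append:
  assumes "reduced_word W S (us @ vs)"
  shows "reduced_word W S us" "reduced_word W S vs"
proof -
  have l: "us \<in> lists S" "vs \<in> lists S" "len (val us \<otimes> val vs) = length us + length vs"
    using assms by (auto simp: reduced_word_def val_append)
  have "len (val us \<otimes> val vs) \<le> len (val us) + len (val vs)" using l by (intro len_mult_le) auto
  then show "reduced_word W S us" "reduced_word W S vs"
    using l len_val_le[of us] len_val_le[of vs] by (auto simp: reduced_word_def)
qed

lemma reduced_word_rev: "reduced_word W S (rev ws) \<longleftrightarrow> reduced_word W S ws"
  unfolding reduced_word_def by (cases "ws \<in> lists S") (auto simp: val_rev)

lemma reduced_word_append_iff:
  assumes "reduced_word W S us" "reduced_word W S vs"
  shows "reduced_word W S (us @ vs) \<longleftrightarrow> len (val us \<otimes> val vs) = len (val us) + len (val vs)"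
  using assms unfolding reduced_word_def by (auto simp: val_append)

lemma ex_right_descent:
  assumes w: "w \<in> carrier W" "w \<noteq> \<one>"
  shows "\<exists>s\<in>S. len w = Suc (len (w \<otimes> s))"
proof -
  obtain ws where ws: "reduced_word W S ws" "val ws = w" using ex_reduced_word[OF w(1)] by auto
  then have "ws \<noteq> []" using w by auto
  then obtain us s where us: "ws = us @ [s]" by (cases ws rule: rev_cases) auto
  have l: "us \<in> lists S" "s \<in> S" using ws us by (auto simp: reduced_word_def)
  have "val us = w \<otimes> s" using ws us l by (auto simp: val_append)
  moreover have "len (val us) = length us" "len w = length ws"
    using reduced_word_append(1)[of us "[s]"] ws us by (auto simp: reduced_word_def)
  ultimately have "len w = Suc (len (w \<otimes> s))" using us by simp
  then show ?thesis using l by blast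
qed

section \<open>The linear representation of the group\<close>

definition rho :: "'a \<Rightarrow> ('a \<Rightarrow> real) \<Rightarrow> 'a \<Rightarrow> real" where
  "rho w = act (SOME ws. ws \<in> lists S \<and> val ws = w)"

text \<open>Independence of the chosen word: words with equal product are congruent by the
  presentation, and congruent words act alike.\<close>

lemma rho_val: "ws \<in> lists S \<Longrightarrow> rho (val ws) = act ws"
proof -
  assume ws: "ws \<in> lists S"
  let ?us = "SOME us. us \<in> lists S \<and> val us = val ws"
  have "?us \<in> lists S \<and> val ?us = val ws" by (rule someI[of _ ws]) (simp add: ws)
  then have "coxeter_cong S m ?us ws" using word_prod_eq_iff ws by blast
  then show ?thesis unfolding rho_def by (rule coxeter_cong_act)
qed

lemma rho_one [simp]: "rho \<one> = id"
  using rho_val[of "[]"] by simp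

lemma rho_gen: "s \<in> S \<Longrightarrow> rho s = reflect (simple s)"
  using rho_val[of "[s]"] by simp

lemma rho_mult: "u \<in> carrier W \<Longrightarrow> v \<in> carrier W \<Longrightarrow> rho (u \<otimes> v) = rho u \<circ> rho v"
proof -
  assume u: "u \<in> carrier W" and v: "v \<in> carrier W"
  obtain us where us: "us \<in> lists S" "val us = u" using ex_word[OF u] by auto
  obtain vs where vs: "vs \<in> lists S" "val vs = v" using ex_word[OF v] by auto
  show ?thesis using rho_val[of "us @ vs"] us vs rho_val[of us] rho_val[of vs]
    by (simp add: val_append act_append)
qed

lemma rho_mult_apply: "u \<in> carrier W \<Longrightarrow> v \<in> carrier W \<Longrightarrow> rho (u \<otimes> v) x = rho u (rho v x)"
  by (simp add: rho_mult)

lemma rho_inv_rho [simp]: "w \<in> carrier W \<Longrightarrow> rho (inv w) (rho w x) = x"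
  using rho_mult_apply[of "inv w" w x] by simp

lemma rho_rho_inv [simp]: "w \<in> carrier W \<Longrightarrow> rho w (rho (inv w) x) = x"
  using rho_mult_apply[of w "inv w" x] by simp

lemma rho_comb: "w \<in> carrier W \<Longrightarrow> rho w (\<lambda>x. a * u x + c * v x) = (\<lambda>x. a * rho w u x + c * rho w v x)"
  unfolding rho_def by (rule act_comb)

lemma rho_minus: "w \<in> carrier W \<Longrightarrow> rho w (\<lambda>x. - v x) = (\<lambda>x. - rho w v x)"
  using rho_comb[of w "- 1" v 0 v] by simp

lemma bil_rho: "w \<in> carrier W \<Longrightarrow> bil (rho w u) (rho w v) = bil u v"
  using ex_word[of w] rho_val bil_act by metis

lemma rho_off: "w \<in> carrier W \<Longrightarrow> t \<notin> S \<Longrightarrow> rho w v t = v t"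
  using ex_word[of w] rho_val act_off by metis

lemma rho_reflect: "w \<in> carrier W \<Longrightarrow> rho w (reflect u v) = reflect (rho w u) (rho w v)"
  using rho_comb[of w 1 v "- 2 * bil u v" u] unfolding reflect_def by (simp add: bil_rho)

section \<open>Positivity of images of simple roots\<close>

definition pos :: "('a \<Rightarrow> real) \<Rightarrow> bool" where "pos v \<longleftrightarrow> (\<forall>t. 0 \<le> v t)"
definition neg :: "('a \<Rightarrow> real) \<Rightarrow> bool" where "neg v \<longleftrightarrow> pos (\<lambda>t. - v t)"

lemma pos_comb: "pos u \<Longrightarrow> pos v \<Longrightarrow> 0 \<le> a \<Longrightarrow> 0 \<le> c \<Longrightarrow> pos (\<lambda>x. a * u x + c * v x)"
  by (simp add: pos_def)

lemma pos_simple: "pos (simple s)"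
  by (simp add: pos_def simple_def)

text \<open>Alternating words are built so that the last letter is \<open>s\<close> and shorter ones
  are suffixes of longer ones (\<open>alt_drop\<close>).\<close>

fun alt :: "nat \<Rightarrow> 'a \<Rightarrow> 'a \<Rightarrow> 'a list" where
  "alt 0 s t = []"
| "alt (Suc n) s t = alt n t s @ [s]"

lemma length_alt [simp]: "length (alt n s t) = n"
  by (induction n arbitrary: s t) auto

lemma alt_lists: "s \<in> S \<Longrightarrow> t \<in> S \<Longrightarrow> alt n s t \<in> lists S"
  by (induction n arbitrary: s t) auto

lemma alt_even: "alt (2 * n) t s = concat (replicate n [s, t])"
proof (induction n)
  case (Suc n)
  have "concat (replicate k [s, t]) @ [s, t] = [s, t] @ concat (replicate k [s, t])" for k
    by (induction k) auto
  then show ?case using Suc by simp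
qed simp

lemma alt_drop: "k \<le> n \<Longrightarrow> \<exists>xs. alt n s t = xs @ alt k s t"
proof (induction n arbitrary: k s t)
  case (Suc n)
  show ?case
  proof (cases k)
    case (Suc j)
    then obtain xs where "alt n t s = xs @ alt j t s" using Suc.IH[of j t s] Suc.prems by auto
    then show ?thesis using Suc by simp
  qed simp
qed simp

lemma reduced_pair_alt:
  assumes "ds \<in> lists {s, t}" "s \<in> S" "t \<in> S" "reduced_word W S (ds @ [s])"
  shows "ds @ [s] = alt (Suc (length ds)) s t"
  using assms
proof (induction ds arbitrary: s t rule: rev_induct)
  case (snoc d ds)
  have r: "reduced_word W S (ds @ [d])" using reduced_word_append(1) snoc.prems(4) by simp
  have "reduced_word W S [d, s]" using reduced_word_append(2)[of ds "[d, s]"] snoc.prems(4) by simp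
  then have "d \<noteq> s" using snoc.prems by (auto simp: reduced_word_def)
  then have d: "d = t" using snoc.prems by auto
  have "ds @ [t] = alt (Suc (length ds)) t s"
    using snoc.IH[of t s] snoc.prems r d by (simp add: insert_commute)
  then show ?case using d by simp
qed simp

text \<open>The alternating word of length \<open>2 * m s t\<close> is a relator, so its suffix of
  length \<open>m s t + 1\<close> is the inverse, in the group, of the remaining prefix of
  \<open>m s t - 1\<close> letters and cannot be reduced.\<close>

lemma reduced_alt_le:
  assumes s: "s \<in> S" and t: "t \<in> S" and r: "reduced_word W S (alt n s t)" and m: "m s t \<noteq> 0"
  shows "n \<le> m s t"
proof (rule ccontr)
  assume "\<not> n \<le> m s t"
  then have "Suc (m s t) \<le> n" by simp
  then obtain xs where "alt n s t = xs @ alt (Suc (m s t)) s t" using alt_drop by blast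
  then have r2: "reduced_word W S (alt (Suc (m s t)) s t)" using r reduced_word_append(2) by metis
  have "Suc (m s t) \<le> 2 * m s t" using m by simp
  then obtain ys where ys: "alt (2 * m s t) s t = ys @ alt (Suc (m s t)) s t" using alt_drop by blast
  have "alt (2 * m s t) s t \<in> lists S" using alt_lists s t by blast
  then have l: "ys \<in> lists S" "alt (Suc (m s t)) s t \<in> lists S" unfolding ys by auto
  have len_ys: "length ys + Suc (m s t) = 2 * m s t"
    using arg_cong[OF ys, of length] by simp
  have "coxeter_cong S m ([] @ concat (replicate (m t s) [t, s]) @ []) ([] @ [])"
    using s t by (intro coxeter_cong.relator) auto
  then have "val (alt (2 * m s t) s t) = val []"
    using word_prod_eq_iff[of "alt (2 * m s t) s t" "[]"] s t alt_lists[OF s t, of "2 * m s t"]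
    by (simp add: alt_even m_sym)
  then have "val ys \<otimes> val (alt (Suc (m s t)) s t) = \<one>" using l by (simp add: ys val_append)
  then have "val (alt (Suc (m s t)) s t) = inv (val ys)"
    using l by (metis inv_equality inv_inv val_closed)
  then have "len (val (alt (Suc (m s t)) s t)) = len (val ys)" using l by simp
  then show False using r2 len_val_le[OF l(1)] len_ys by (simp add: reduced_word_def del: alt.simps)
qed

text \<open>With \<open>k = cos \<theta>\<close> these are the numbers \<open>sin (n \<theta>) / sin \<theta>\<close>: the coordinates of the roots
  of a dihedral group with respect to two roots \<open>u\<close>, \<open>v\<close> with \<open>bil u v = - k\<close>.\<close>

fun cheb :: "real \<Rightarrow> nat \<Rightarrow> real" where
  "cheb k 0 = 0"
| "cheb k (Suc 0) = 1"
| "cheb k (Suc (Suc n)) = 2 * k * cheb k (Suc n) - cheb k n"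

lemma cheb_sin: "cheb (cos \<theta>) n * sin \<theta> = sin (n * \<theta>)"
proof (induction "cos \<theta>" n rule: cheb.induct)
  case (3 n)
  have "sin (real (Suc n) * \<theta> + \<theta>) + sin (real (Suc n) * \<theta> - \<theta>) = 2 * cos \<theta> * sin (real (Suc n) * \<theta>)"
    by (simp add: sin_add sin_diff)
  moreover have "real (Suc n) * \<theta> + \<theta> = real (Suc (Suc n)) * \<theta>" "real (Suc n) * \<theta> - \<theta> = real n * \<theta>"
    by (simp_all add: algebra_simps)
  ultimately have "sin (real (Suc (Suc n)) * \<theta>) = 2 * cos \<theta> * sin (real (Suc n) * \<theta>) - sin (real n * \<theta>)"
    by simp
  then show ?case using 3 by (simp add: algebra_simps)
qed simp_all

lemma cheb_increasing: "1 \<le> k \<Longrightarrow> 0 \<le> cheb k n \<and> cheb k n + 1 \<le> cheb k (Suc n)"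
proof (induction n)
  case (Suc n)
  then have "1 * cheb k (Suc n) \<le> k * cheb k (Suc n)" by (intro mult_right_mono) auto
  moreover have "2 * k * cheb k (Suc n) = 2 * (k * cheb k (Suc n))" by simp
  ultimately show ?case using Suc unfolding cheb.simps by linarith
qed simp

text \<open>For finite \<open>m s t\<close> the angle is \<open>pi / m s t\<close>, and
  \<open>n\<close> times it is at most \<open>pi\<close>, where the sine is nonnegative. For
  infinite \<open>m s t\<close> the parameter is \<open>1\<close> and the numbers increase.\<close>

lemma cheb_nonneg:
  assumes "s \<in> S" "t \<in> S" "s \<noteq> t" "m s t = 0 \<or> n \<le> m s t"
  shows "0 \<le> cheb (- form_coeff s t) n"
proof (cases "m s t = 0")
  case False
  have m2: "2 \<le> m s t" using m_off_diag[OF assms(1-3)] False by linarith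
  have s: "0 < sin (pi / m s t)" using m2 by (intro sin_gt_zero) (auto simp: field_simps)
  have "0 \<le> sin (n * (pi / m s t))"
    using assms(4) False by (intro sin_ge_zero) (auto simp: field_simps)
  then have "0 \<le> cheb (cos (pi / m s t)) n * sin (pi / m s t)" by (simp add: cheb_sin)
  then show ?thesis using s False by (simp add: form_coeff_def zero_le_mult_iff)
next
  case True
  then show ?thesis using cheb_increasing[of 1 n] by (simp add: form_coeff_def)
qed

text \<open>Each letter moves to the next root of the rank-two system: by the recurrence of
  \<open>cheb\<close> the coordinates with index \<open>j\<close> become those with index
  \<open>j + 1\<close>, with \<open>s\<close> and \<open>t\<close> exchanged. Hence
  \<open>j\<close>, \<open>s\<close> and \<open>t\<close> all vary in the induction.\<close>

lemma act_alt_nonneg: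
  assumes "s \<in> S" "t \<in> S" "s \<noteq> t" "m s t = 0 \<or> Suc (j + n) \<le> m s t"
  shows "\<exists>a c. 0 \<le> a \<and> 0 \<le> c \<and>
    act (alt n t s) (\<lambda>x. cheb (- form_coeff s t) (Suc j) * simple s x + cheb (- form_coeff s t) j * simple t x) =
      (\<lambda>x. a * simple s x + c * simple t x)"
  using assms
proof (induction n arbitrary: j s t)
  case 0
  then show ?case
    using cheb_nonneg[of s t "Suc j"] cheb_nonneg[of s t j]
    by (intro exI[of _ "cheb (- form_coeff s t) (Suc j)"] exI[of _ "cheb (- form_coeff s t) j"]) auto
next
  case (Suc n)
  let ?p = "cheb (- form_coeff s t)"
  have bts: "bil (simple t) (simple s) = form_coeff s t"
    using Suc.prems by (simp add: bil_simple form_coeff_sym[of t s])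
  have bv: "bil (simple t) (\<lambda>x. ?p (Suc j) * simple s x + ?p j * simple t x) = form_coeff s t * ?p (Suc j) + ?p j"
    using Suc.prems by (simp add: bil_comb_right bts bil_simple_self)
  then have step: "reflect (simple t) (\<lambda>x. ?p (Suc j) * simple s x + ?p j * simple t x) =
     (\<lambda>x. cheb (- form_coeff t s) (Suc (Suc j)) * simple t x + cheb (- form_coeff t s) (Suc j) * simple s x)"
    unfolding reflect_def bv using Suc.prems by (simp add: form_coeff_sym[of t s] fun_eq_iff algebra_simps)
  obtain a c where ac: "0 \<le> a" "0 \<le> c"
    "act (alt n s t) (\<lambda>x. cheb (- form_coeff t s) (Suc (Suc j)) * simple t x + cheb (- form_coeff t s) (Suc j) * simple s x) =
      (\<lambda>x. a * simple t x + c * simple s x)"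
    using Suc.IH[of t s "Suc j"] Suc.prems m_sym[of s t] by auto
  have "act (alt (Suc n) t s) (\<lambda>x. ?p (Suc j) * simple s x + ?p j * simple t x) =
      (\<lambda>x. c * simple s x + a * simple t x)"
    by (simp only: alt.simps act_append act_simps o_apply id_apply comp_id step ac(3)) (simp only: add.commute)
  then show ?case using ac(1,2) by blast
qed

text \<open>For a descent \<open>t\<close> of \<open>w\<close>, split \<open>w\<close> into
  \<open>v\<close> and a word \<open>ds\<close> in \<open>s\<close> and \<open>t\<close>, with
  \<open>v\<close> as short as possible. By induction \<open>v\<close> keeps \<open>simple s\<close>
  and \<open>simple t\<close> positive, and \<open>ds\<close> maps \<open>simple s\<close> to a
  nonnegative combination of these two.\<close>

theorem rho_simple_pos:
  assumes "w \<in> carrier W" "s \<in> S" "len (w \<otimes> s) = Suc (len w)"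
  shows "pos (rho w (simple s))"
  using assms
proof (induction "len w" arbitrary: w s rule: less_induct)
  case (less w s)
  show ?case
  proof (cases "w = \<one>")
    case True
    then show ?thesis by (simp add: pos_simple)
  next
    case False
    then obtain t where t: "t \<in> S" "len w = Suc (len (w \<otimes> t))"
      using ex_right_descent less.prems by blast
    have st: "s \<noteq> t" using t less.prems by auto
    \<comment> \<open>A factorization in \<open>P\<close> with the shortest \<open>v\<close> gives
      the minimal representative of the coset of \<open>w\<close> modulo the subgroup generated by
      \<open>s\<close> and \<open>t\<close>: a descent \<open>r\<close> of \<open>v\<close> could be
      moved into the word.\<close>
    define P where "P = (\<lambda>v ds. v \<in> carrier W \<and> ds \<in> lists {s, t} \<and> w = v \<otimes> val ds \<and> len w = len v + length ds)"
    have P0: "P (w \<otimes> t) [t]" using t less.prems by (auto simp: P_def)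
    define k where "k = (LEAST k. \<exists>v ds. P v ds \<and> len v = k)"
    have "\<exists>v ds. P v ds \<and> len v = k" unfolding k_def
      by (rule LeastI_ex) (use P0 in blast)
    then obtain v ds where v: "P v ds" "len v = k" by blast
    have min: "k \<le> len v'" if "P v' ds'" for v' ds' unfolding k_def
      by (rule Least_le) (use that in blast)
    have vc: "v \<in> carrier W" and ds: "ds \<in> lists {s, t}" and w: "w = v \<otimes> val ds"
      and lw: "len w = len v + length ds" using v by (auto simp: P_def)
    have dsS: "ds \<in> lists S" using ds less.prems t by (auto simp: in_lists_conv_set)
    have lv: "len v < len w" using min[OF P0] t v by simp
    have up: "len (v \<otimes> r) = Suc (len v)" if r: "r \<in> {s, t}" for r
    proof (rule ccontr)
      assume n: "len (v \<otimes> r) \<noteq> Suc (len v)"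
      have rS: "r \<in> S" using r t less.prems by auto
      then have l: "len v = Suc (len (v \<otimes> r))" using len_mult_gen[OF vc rS] n by auto
      have "v \<otimes> r \<otimes> (r \<otimes> val ds) = v \<otimes> val ds"
        using vc rS dsS by (simp add: m_assoc)
      then have "P (v \<otimes> r) (r # ds)" using ds r rS vc w lw l by (auto simp: P_def)
      then show False using min l v by fastforce
    qed
    have ps: "pos (rho v (simple s))" using less.hyps[OF lv vc less.prems(2) up] by auto
    have pt: "pos (rho v (simple t))" using less.hyps[OF lv vc t(1) up] by auto
    \<comment> \<open>Since \<open>w \<otimes> s\<close> is longer than \<open>w\<close>, the word
      \<open>ds @ [s]\<close> is reduced, hence alternating and, unless \<open>m s t = 0\<close>, of
      length at most \<open>m s t\<close>.\<close>
    have "len (v \<otimes> val (ds @ [s])) \<le> len v + len (val (ds @ [s]))"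
      using vc dsS less.prems by (intro len_mult_le) auto
    moreover have "v \<otimes> val (ds @ [s]) = w \<otimes> s"
      using vc dsS less.prems(2) by (simp add: w val_append m_assoc)
    ultimately have "len v + Suc (length ds) \<le> len v + len (val (ds @ [s]))"
      using less.prems lw by simp
    then have red: "reduced_word W S (ds @ [s])"
      using len_val_le[of "ds @ [s]"] dsS less.prems by (auto simp: reduced_word_def)
    have alt: "ds @ [s] = alt (Suc (length ds)) s t"
      by (rule reduced_pair_alt[OF ds less.prems(2) t(1) red])
    then have ds_alt: "ds = alt (length ds) t s" by simp
    have "m s t = 0 \<or> Suc (length ds) \<le> m s t"
      using reduced_alt_le[OF less.prems(2) t(1), of "Suc (length ds)"] red alt by auto
    then obtain a c where ac: "0 \<le> a" "0 \<le> c"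
      "act ds (\<lambda>x. cheb (- form_coeff s t) (Suc 0) * simple s x + cheb (- form_coeff s t) 0 * simple t x) =
        (\<lambda>x. a * simple s x + c * simple t x)"
      using act_alt_nonneg[OF less.prems(2) t(1) st, of 0 "length ds"] ds_alt by auto
    have "act ds (simple s) = (\<lambda>x. a * simple s x + c * simple t x)"
      using ac(3) by simp
    then have "rho w (simple s) = (\<lambda>x. a * rho v (simple s) x + c * rho v (simple t) x)"
      using vc dsS by (simp add: w rho_mult rho_val rho_comb)
    then show ?thesis using pos_comb[OF ps pt] ac by simp
  qed
qed

subsection \<open>Roots, inversions and dominance\<close>

definition roots :: "('a \<Rightarrow> real) set" where
  "roots = {rho w (simple s) | w s. w \<in> carrier W \<and> s \<in> S}"

definition pos_roots :: "('a \<Rightarrow> real) set" where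
  "pos_roots = {\<beta> \<in> roots. pos \<beta>}"

text \<open>These are the right inversions: the simple roots among them are the right descents of
  \<open>w\<close>.\<close>

definition inversions :: "'a \<Rightarrow> ('a \<Rightarrow> real) set" where
  "inversions w = {\<beta> \<in> pos_roots. neg (rho w \<beta>)}"

lemma pos_minus [simp]: "pos (\<lambda>x. - v x) \<longleftrightarrow> neg v" and neg_minus [simp]: "neg (\<lambda>x. - v x) \<longleftrightarrow> pos v"
  by (simp_all add: neg_def)

lemma reflect_self: "bil u u = 1 \<Longrightarrow> reflect u u = (\<lambda>x. - u x)"
  by (simp add: reflect_def fun_eq_iff)

lemma rho_gen_simple: "s \<in> S \<Longrightarrow> rho s (simple s) = (\<lambda>x. - simple s x)"
  by (simp add: rho_gen reflect_self bil_simple_self)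

lemma rho_mult_gen_simple: "w \<in> carrier W \<Longrightarrow> s \<in> S \<Longrightarrow> rho (w \<otimes> s) (simple s) = (\<lambda>x. - rho w (simple s) x)"
  by (simp add: rho_mult_apply rho_gen_simple rho_minus)

lemma rootI: "w \<in> carrier W \<Longrightarrow> s \<in> S \<Longrightarrow> rho w (simple s) \<in> roots"
  by (auto simp: roots_def)

lemma simple_root: "s \<in> S \<Longrightarrow> simple s \<in> roots"
  using rootI[of \<one> s] by simp

lemma simple_pos_root: "s \<in> S \<Longrightarrow> simple s \<in> pos_roots"
  by (simp add: pos_roots_def simple_root pos_simple)

lemma rho_root: "w \<in> carrier W \<Longrightarrow> \<beta> \<in> roots \<Longrightarrow> rho w \<beta> \<in> roots"
proof -
  assume w: "w \<in> carrier W" and "\<beta> \<in> roots"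
  then obtain v s where v: "v \<in> carrier W" "s \<in> S" "\<beta> = rho v (simple s)" by (auto simp: roots_def)
  then have "rho w \<beta> = rho (w \<otimes> v) (simple s)" using w by (simp add: rho_mult_apply)
  then show ?thesis using rootI[of "w \<otimes> v" s] v w by simp
qed

lemma minus_root: "\<beta> \<in> roots \<Longrightarrow> (\<lambda>x. - \<beta> x) \<in> roots"
proof -
  assume "\<beta> \<in> roots"
  then obtain v s where v: "v \<in> carrier W" "s \<in> S" "\<beta> = rho v (simple s)" by (auto simp: roots_def)
  then show ?thesis using rootI[of "v \<otimes> s" s] by (simp add: rho_mult_gen_simple)
qed

lemma bil_root: "\<beta> \<in> roots \<Longrightarrow> bil \<beta> \<beta> = 1"
  by (auto simp: roots_def bil_rho bil_simple_self)

lemma root_off: "\<beta> \<in> roots \<Longrightarrow> t \<notin> S \<Longrightarrow> \<beta> t = 0"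
  by (auto simp: roots_def rho_off simple_def)

lemma rho_simple_neg:
  assumes "w \<in> carrier W" "s \<in> S" "len w = Suc (len (w \<otimes> s))"
  shows "neg (rho w (simple s))"
  using rho_simple_pos[of "w \<otimes> s" s] assms by (simp add: rho_mult_gen_simple)

lemma root_pos_or_neg: "\<beta> \<in> roots \<Longrightarrow> pos \<beta> \<or> neg \<beta>"
  using rho_simple_pos rho_simple_neg len_mult_gen unfolding roots_def by blast

lemma not_pos_neg: "\<beta> \<in> roots \<Longrightarrow> pos \<beta> \<Longrightarrow> neg \<beta> \<Longrightarrow> False"
proof -
  assume r: "\<beta> \<in> roots" and "pos \<beta>" "neg \<beta>"
  then have "\<beta> t = 0" for t unfolding pos_def neg_def by (metis neg_0_le_iff_le order_antisym)
  then have "bil \<beta> \<beta> = 0" by (simp add: bil_def)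
  then show False using bil_root[OF r] by simp
qed

lemma neg_iff_not_pos: "\<beta> \<in> roots \<Longrightarrow> neg \<beta> \<longleftrightarrow> \<not> pos \<beta>"
  using root_pos_or_neg not_pos_neg by blast

lemma pos_roots_not_neg: "\<beta> \<in> pos_roots \<Longrightarrow> \<not> neg \<beta>"
  by (simp add: pos_roots_def neg_iff_not_pos)

text \<open>Both roots have norm one, so the factor is \<open>1\<close> or \<open>- 1\<close>, and
  positivity excludes \<open>- 1\<close>.\<close>

lemma pos_root_proportional:
  assumes "\<beta> \<in> pos_roots" "\<gamma> \<in> pos_roots" "\<And>x. a * \<beta> x = c * \<gamma> x" "a \<noteq> 0"
  shows "\<beta> = \<gamma>"
proof -
  define k where "k = c / a"
  have b: "\<beta> = (\<lambda>x. k * \<gamma> x + 0 * \<gamma> x)" using assms(3,4) by (auto simp: k_def field_simps)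
  have "bil \<beta> \<beta> = k\<^sup>2"
    unfolding b bil_comb_right bil_comb_left using bil_root[of \<gamma>] assms(2)
    by (simp add: pos_roots_def power2_eq_square)
  then have "k\<^sup>2 = 1" using bil_root assms(1) by (simp add: pos_roots_def)
  then have "k = 1 \<or> k = - 1" by (simp add: power2_eq_1_iff)
  moreover have "k \<noteq> - 1"
  proof
    assume "k = - 1"
    then have "\<beta> = (\<lambda>x. - \<gamma> x)" using b by simp
    then have "neg \<beta>" using assms(2) by (simp add: pos_roots_def)
    then show False using pos_roots_not_neg assms(1) by blast
  qed
  ultimately show ?thesis using b by simp
qed

lemma pos_root_eq_simple:
  assumes "\<beta> \<in> pos_roots" "s \<in> S" "\<And>t. t \<noteq> s \<Longrightarrow> \<beta> t = 0"
  shows "\<beta> = simple s"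
proof (rule pos_root_proportional[OF assms(1) simple_pos_root[OF assms(2)], of 1 "\<beta> s"])
  show "1 * \<beta> x = \<beta> s * simple s x" for x using assms(3)[of x] by (auto simp: simple_def)
qed simp

lemma pos_root_coordinate:
  assumes "\<beta> \<in> pos_roots" "s \<in> S" "\<beta> \<noteq> simple s"
  obtains t where "t \<noteq> s" "0 < \<beta> t"
  using pos_root_eq_simple[OF assms(1,2)] assms that unfolding pos_roots_def pos_def
  by (metis (no_types, lifting) mem_Collect_eq order_le_less)

text \<open>The reflection changes only the coordinate at \<open>s\<close>, and a positive root
  other than \<open>simple s\<close> has a further positive coordinate.\<close>

lemma pos_rho_gen:
  assumes "\<beta> \<in> pos_roots" "s \<in> S" "\<beta> \<noteq> simple s"
  shows "rho s \<beta> \<in> pos_roots"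
proof -
  obtain t where t: "t \<noteq> s" "0 < \<beta> t" using pos_root_coordinate[OF assms] .
  have r: "rho s \<beta> \<in> roots" using assms by (intro rho_root) (auto simp: pos_roots_def)
  have "rho s \<beta> t = \<beta> t" using t(1) assms(2) by (simp add: rho_gen reflect_def simple_def)
  then have "\<not> neg (rho s \<beta>)" using t unfolding neg_def pos_def by (auto intro!: exI[of _ t])
  then show ?thesis using r neg_iff_not_pos by (simp add: pos_roots_def)
qed

lemma inversions_pos_root: "\<beta> \<in> inversions w \<Longrightarrow> \<beta> \<in> pos_roots"
  by (simp add: inversions_def)

lemma not_inversionsD: "\<beta> \<in> pos_roots \<Longrightarrow> w \<in> carrier W \<Longrightarrow> \<beta> \<notin> inversions w \<Longrightarrow> rho w \<beta> \<in> pos_roots"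
  using rho_root neg_iff_not_pos by (auto simp: inversions_def pos_roots_def)

lemma inversions_one: "inversions \<one> = {}"
  using pos_roots_not_neg by (auto simp: inversions_def)

lemma simple_in_inversions_iff:
  assumes "w \<in> carrier W" "s \<in> S"
  shows "simple s \<in> inversions w \<longleftrightarrow> len w = Suc (len (w \<otimes> s))"
  using len_mult_gen[OF assms] rho_simple_pos[OF assms] rho_simple_neg[OF assms]
    not_pos_neg[OF rootI[OF assms]] simple_pos_root[OF assms(2)] by (auto simp: inversions_def)

lemma simple_inversion_descent:
  "w \<in> carrier W \<Longrightarrow> s \<in> S \<Longrightarrow> simple s \<in> inversions w \<Longrightarrow> len (w \<otimes> s) < len w"
  by (simp add: simple_in_inversions_iff)

lemma inversions_gen_mult:
  assumes "w \<in> carrier W" "r \<in> S" "\<beta> \<in> inversions (r \<otimes> w)" "\<beta> \<notin> inversions w"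
  shows "rho w \<beta> = simple r"
proof (rule ccontr)
  assume n: "rho w \<beta> \<noteq> simple r"
  have "rho w \<beta> \<in> pos_roots" using not_inversionsD assms inversions_pos_root by blast
  then have "rho r (rho w \<beta>) \<in> pos_roots" using pos_rho_gen assms(2) n by blast
  then show False using assms pos_roots_not_neg by (auto simp: inversions_def rho_mult_apply)
qed

lemma inversions_mult_gen:
  assumes w: "w \<in> carrier W" and s: "s \<in> S" and l: "len (w \<otimes> s) = Suc (len w)"
  shows "inversions (w \<otimes> s) = insert (simple s) (rho s ` inversions w)"
    and "simple s \<notin> rho s ` inversions w"
proof -
  have ns: "simple s \<notin> inversions w" using simple_inversion_descent[OF w s] l by auto
  have gg: "rho s (rho s \<beta>) = \<beta>" for \<beta>
    using s by (simp add: rho_gen reflect_reflect bil_simple_self)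
  show "inversions (w \<otimes> s) = insert (simple s) (rho s ` inversions w)"
  proof (intro equalityI subsetI)
    fix \<beta> assume b: "\<beta> \<in> inversions (w \<otimes> s)"
    show "\<beta> \<in> insert (simple s) (rho s ` inversions w)"
    proof (cases "\<beta> = simple s")
      case False
      then have "rho s \<beta> \<in> pos_roots" using pos_rho_gen[OF inversions_pos_root[OF b] s] by blast
      then have "rho s \<beta> \<in> inversions w" using b w s by (simp add: inversions_def rho_mult_apply)
      then show ?thesis using gg by (metis image_eqI insertI2)
    qed simp
  next
    fix \<beta> assume "\<beta> \<in> insert (simple s) (rho s ` inversions w)"
    then consider "\<beta> = simple s" | \<gamma> where "\<gamma> \<in> inversions w" "\<beta> = rho s \<gamma>" by blast
    then show "\<beta> \<in> inversions (w \<otimes> s)"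
    proof cases
      case 1
      then show ?thesis using simple_in_inversions_iff[of "w \<otimes> s" s] w s l by simp
    next
      case 2
      then have "\<gamma> \<noteq> simple s" using ns by blast
      then have "\<beta> \<in> pos_roots" using 2 pos_rho_gen[OF inversions_pos_root s] by blast
      then show ?thesis using 2 w s gg by (simp add: inversions_def rho_mult_apply)
    qed
  qed
  show "simple s \<notin> rho s ` inversions w"
  proof
    assume "simple s \<in> rho s ` inversions w"
    then obtain \<gamma> where g: "\<gamma> \<in> inversions w" "simple s = rho s \<gamma>" by blast
    then have "\<gamma> = (\<lambda>x. - simple s x)" using gg[of \<gamma>] rho_gen_simple[OF s] by metis
    then have "neg \<gamma>" by (simp add: pos_simple)
    then show False using g inversions_pos_root pos_roots_not_neg by blast
  qed
qed

lemma finite_card_inversions: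
  "w \<in> carrier W \<Longrightarrow> finite (inversions w) \<and> card (inversions w) = len w"
proof (induction "len w" arbitrary: w)
  case 0
  then show ?case using len_zero[of w] by (simp add: inversions_one)
next
  case (Suc n)
  then have "w \<noteq> \<one>" by auto
  then obtain s where s: "s \<in> S" "len w = Suc (len (w \<otimes> s))" using ex_right_descent Suc.prems by blast
  let ?v = "w \<otimes> s"
  have v: "?v \<in> carrier W" "len (?v \<otimes> s) = Suc (len ?v)" "?v \<otimes> s = w" using s Suc.prems by auto
  have IH: "finite (inversions ?v) \<and> card (inversions ?v) = len ?v" using Suc v s by auto
  have "inj_on (rho s) (inversions ?v)"
    using s by (intro inj_on_inverseI[of _ "rho s"]) (simp add: rho_gen reflect_reflect bil_simple_self)
  then show ?case using inversions_mult_gen[OF v(1) s(1) v(2)] IH s v(3) by (simp add: card_image)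
qed

lemma finite_inversions: "w \<in> carrier W \<Longrightarrow> finite (inversions w)"
  using finite_card_inversions by blast

definition pos_part :: "('a \<Rightarrow> real) \<Rightarrow> 'a \<Rightarrow> real" where
  "pos_part \<beta> = (if pos \<beta> then \<beta> else (\<lambda>x. - \<beta> x))"

lemma inj_on_pos_part_rho:
  assumes v: "v \<in> carrier W" shows "inj_on (\<lambda>\<beta>. pos_part (rho v \<beta>)) pos_roots"
proof (rule inj_onI)
  fix \<beta> \<gamma> assume b: "\<beta> \<in> pos_roots" and g: "\<gamma> \<in> pos_roots"
    and e: "pos_part (rho v \<beta>) = pos_part (rho v \<gamma>)"
  have "\<exists>a. a \<noteq> 0 \<and> (\<forall>x. pos_part \<delta> x = a * \<delta> x)" for \<delta>
    unfolding pos_part_def by (rule exI[of _ "if pos \<delta> then 1 else - 1"]) auto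
  then obtain a c where ac: "a \<noteq> 0" "\<And>x. pos_part (rho v \<beta>) x = a * rho v \<beta> x"
    "\<And>x. pos_part (rho v \<gamma>) x = c * rho v \<gamma> x" by metis
  have "(\<lambda>x. a * rho v \<beta> x) = (\<lambda>x. c * rho v \<gamma> x)" using e ac by auto
  then have "rho (inv v) (\<lambda>x. a * rho v \<beta> x + 0 * rho v \<beta> x) = rho (inv v) (\<lambda>x. c * rho v \<gamma> x + 0 * rho v \<gamma> x)"
    by simp
  then have "(\<lambda>x. a * \<beta> x) = (\<lambda>x. c * \<gamma> x)"
    unfolding rho_comb[OF inv_closed[OF v]] using v by simp
  then show "\<beta> = \<gamma>" using pos_root_proportional[OF b g, of a c] ac(1) by metis
qed

text \<open>Up to sign, \<open>v\<close> carries the inversions of \<open>u \<otimes> v\<close> to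
  the symmetric difference of those of \<open>u\<close> and of \<open>inv v\<close>: a root changes
  sign under the product iff it does so under exactly one of the two successive factors.\<close>

lemma image_inversions_mult:
  assumes u: "u \<in> carrier W" and v: "v \<in> carrier W"
  shows "(\<lambda>\<beta>. pos_part (rho v \<beta>)) ` inversions (u \<otimes> v) =
    (inversions u - inversions (inv v)) \<union> (inversions (inv v) - inversions u)"
    (is "?f ` _ = ?R")
proof (intro equalityI subsetI)
  fix \<delta> assume "\<delta> \<in> ?f ` inversions (u \<otimes> v)"
  then obtain \<beta> where b: "\<beta> \<in> pos_roots" "neg (rho u (rho v \<beta>))" "\<delta> = ?f \<beta>"
    using u v by (auto simp: inversions_def rho_mult_apply)
  have r: "\<beta> \<in> roots" "rho v \<beta> \<in> roots" using b(1) v by (auto simp: pos_roots_def rho_root)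
  show "\<delta> \<in> ?R"
  proof (cases "pos (rho v \<beta>)")
    case True
    then have "\<delta> = rho v \<beta>" by (simp add: b pos_part_def)
    then show ?thesis using True b r v pos_roots_not_neg[OF b(1)] by (auto simp: inversions_def pos_roots_def)
  next
    case False
    then have n: "neg (rho v \<beta>)" using r neg_iff_not_pos by blast
    have d: "\<delta> = (\<lambda>x. - rho v \<beta> x)" using False by (simp add: b pos_part_def)
    have "\<delta> \<in> pos_roots" using n r minus_root by (simp add: d pos_roots_def)
    moreover have "rho (inv v) \<delta> = (\<lambda>x. - \<beta> x)" using v by (simp add: d rho_minus)
    then have "neg (rho (inv v) \<delta>)" using b by (simp add: pos_roots_def)
    moreover have "rho u \<delta> = (\<lambda>x. - rho u (rho v \<beta>) x)" using u by (simp add: d rho_minus)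
    then have "\<not> neg (rho u \<delta>)"
      using not_pos_neg[OF rho_root[OF u r(2)]] b(2) by auto
    ultimately show ?thesis by (simp add: inversions_def)
  qed
next
  fix \<delta> assume d: "\<delta> \<in> ?R"
  then have dp: "\<delta> \<in> pos_roots" using inversions_pos_root by blast
  have iv: "inv v \<in> carrier W" using v by simp
  show "\<delta> \<in> ?f ` inversions (u \<otimes> v)"
  proof (cases "\<delta> \<in> inversions u")
    case True
    then have b: "rho (inv v) \<delta> \<in> pos_roots" using d not_inversionsD[OF dp iv] by blast
    have "rho (inv v) \<delta> \<in> inversions (u \<otimes> v)"
      using b True u v by (simp add: inversions_def rho_mult_apply)
    moreover have "?f (rho (inv v) \<delta>) = \<delta>" using v dp by (simp add: pos_part_def pos_roots_def)
    ultimately show ?thesis by (metis image_eqI)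
  next
    case False
    then have di: "\<delta> \<in> inversions (inv v)" using d by blast
    let ?b = "\<lambda>x. - rho (inv v) \<delta> x"
    have b: "?b \<in> pos_roots" using di minus_root rho_root[OF iv]
      by (auto simp: inversions_def pos_roots_def)
    have vb: "rho v ?b = (\<lambda>x. - \<delta> x)" using v by (simp add: rho_minus)
    have "pos (rho u \<delta>)" using not_inversionsD[OF dp u False] by (simp add: pos_roots_def)
    then have "?b \<in> inversions (u \<otimes> v)" using b u v
      by (simp add: inversions_def rho_mult_apply vb) (simp add: rho_minus)
    moreover have "?f ?b = \<delta>"
      using pos_roots_not_neg[OF dp] by (simp add: pos_part_def vb)
    ultimately show ?thesis by (metis image_eqI)
  qed
qed

text \<open>Counting the symmetric difference gives \<open>len (u \<otimes> v) = len u + len v - 2 *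
  card (A \<inter> B)\<close>, where \<open>A\<close> and \<open>B\<close> are the two inversion
  sets.\<close>

lemma len_mult_iff:
  assumes u: "u \<in> carrier W" and v: "v \<in> carrier W"
  shows "len (u \<otimes> v) = len u + len v \<longleftrightarrow> inversions u \<inter> inversions (inv v) = {}"
proof -
  let ?A = "inversions u" and ?B = "inversions (inv v)"
  have fin: "finite ?A" "finite ?B" "card ?A = len u" "card ?B = len v"
    using finite_card_inversions[of u] finite_card_inversions[of "inv v"] u v by auto
  have "inj_on (\<lambda>\<beta>. pos_part (rho v \<beta>)) (inversions (u \<otimes> v))"
    by (rule inj_on_subset[OF inj_on_pos_part_rho[OF v]]) (auto simp: inversions_def)
  then have "card (inversions (u \<otimes> v)) = card ((?A - ?B) \<union> (?B - ?A))"
    by (metis card_image image_inversions_mult[OF u v])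
  then have "len (u \<otimes> v) = card (?A - ?B) + card (?B - ?A)"
    using finite_card_inversions[of "u \<otimes> v"] u v fin by (subst card_Un_disjoint[symmetric]) auto
  moreover have "card ?A = card (?A - ?B) + card (?A \<inter> ?B)"
    using fin by (metis Int_commute card_Diff_subset_Int card_Int_Diff add.commute)
  moreover have "card ?B = card (?B - ?A) + card (?A \<inter> ?B)"
    using fin by (metis Int_commute card_Int_Diff add.commute)
  ultimately have "len (u \<otimes> v) = len u + len v \<longleftrightarrow> card (?A \<inter> ?B) = 0" using fin by auto
  then show ?thesis using fin by simp
qed

text \<open>A nontrivial element has a right descent \<open>s\<close> and makes
  \<open>simple s\<close> negative.\<close>

lemma rho_faithful:
  assumes g: "g \<in> carrier W" and id: "\<And>v. rho g v = v" shows "g = \<one>"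
proof (rule ccontr)
  assume "g \<noteq> \<one>"
  then obtain s where s: "s \<in> S" "len g = Suc (len (g \<otimes> s))" using ex_right_descent g by blast
  then have "neg (simple s)" using rho_simple_neg[OF g] id by simp
  then show False using pos_roots_not_neg simple_pos_root s by blast
qed

lemma rho_conjugate:
  "w \<in> carrier W \<Longrightarrow> s \<in> S \<Longrightarrow> rho (w \<otimes> s \<otimes> inv w) v = reflect (rho w (simple s)) v"
  by (simp add: rho_mult_apply rho_gen rho_reflect)

lemma conjugate_eq_gen:
  assumes z: "z \<in> carrier W" and s: "s \<in> S" and r: "r \<in> S"
    and e: "rho z (simple s) = simple r \<or> rho z (simple s) = (\<lambda>x. - simple r x)"
  shows "z \<otimes> s \<otimes> inv z = r"
proof -
  have "reflect (rho z (simple s)) = reflect (simple r)" using e by (auto simp: reflect_minus_left)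
  then have "rho (z \<otimes> s \<otimes> inv z \<otimes> r) v = v" for v
    using z s r by (simp add: rho_mult_apply[of "z \<otimes> s \<otimes> inv z" r] rho_conjugate rho_gen reflect_reflect bil_simple_self)
  then have "z \<otimes> s \<otimes> inv z \<otimes> r = \<one>" using z s r by (intro rho_faithful) auto
  then show ?thesis using z s r by (metis gen_cancel_right gen_closed inv_closed l_one m_closed)
qed

definition root_reflection :: "('a \<Rightarrow> real) \<Rightarrow> 'a" where
  "root_reflection \<beta> = (SOME t. t \<in> carrier W \<and> (\<forall>v. rho t v = reflect \<beta> v))"

lemma root_reflection:
  assumes "\<beta> \<in> roots"
  shows "root_reflection \<beta> \<in> carrier W" "rho (root_reflection \<beta>) v = reflect \<beta> v"
proof -
  obtain w s where w: "w \<in> carrier W" "s \<in> S" "\<beta> = rho w (simple s)" using assms by (auto simp: roots_def)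
  have "\<exists>t. t \<in> carrier W \<and> (\<forall>v. rho t v = reflect \<beta> v)"
    using w rho_conjugate by (intro exI[of _ "w \<otimes> s \<otimes> inv w"]) auto
  then have "root_reflection \<beta> \<in> carrier W \<and> (\<forall>v. rho (root_reflection \<beta>) v = reflect \<beta> v)"
    unfolding root_reflection_def by (rule someI_ex)
  then show "root_reflection \<beta> \<in> carrier W" "rho (root_reflection \<beta>) v = reflect \<beta> v" by auto
qed

lemma reflect_root: "\<beta> \<in> roots \<Longrightarrow> \<gamma> \<in> roots \<Longrightarrow> reflect \<beta> \<gamma> \<in> roots"
  using root_reflection rho_root by metis

text \<open>By the recurrence of \<open>cheb\<close>, reflecting the first root in
  \<open>\<gamma>\<close> gives the second root of index \<open>n + 1\<close>, and reflecting the
  second in \<open>\<beta>\<close> gives the first.\<close>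

lemma dihedral_roots:
  assumes b: "\<beta> \<in> roots" and g: "\<gamma> \<in> roots" and k: "bil \<beta> \<gamma> = - k"
  shows "(\<lambda>x. cheb k (Suc n) * \<beta> x + cheb k n * \<gamma> x) \<in> roots \<and>
    (\<lambda>x. cheb k n * \<beta> x + cheb k (Suc n) * \<gamma> x) \<in> roots"
proof (induction n)
  case 0
  then show ?case using b g by simp
next
  case (Suc n)
  have k': "bil \<gamma> \<beta> = - k" using k bil_sym by metis
  have 1: "bil \<gamma> (\<lambda>x. cheb k (Suc n) * \<beta> x + cheb k n * \<gamma> x) = cheb k n - k * cheb k (Suc n)"
    by (simp add: bil_comb_right k' bil_root g)
  have 2: "bil \<beta> (\<lambda>x. cheb k n * \<beta> x + cheb k (Suc n) * \<gamma> x) = cheb k n - k * cheb k (Suc n)"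
    by (simp add: bil_comb_right k bil_root b)
  have "reflect \<gamma> (\<lambda>x. cheb k (Suc n) * \<beta> x + cheb k n * \<gamma> x) =
      (\<lambda>x. cheb k (Suc n) * \<beta> x + cheb k (Suc (Suc n)) * \<gamma> x)"
    unfolding reflect_def 1 by (simp add: fun_eq_iff algebra_simps)
  moreover have "reflect \<beta> (\<lambda>x. cheb k n * \<beta> x + cheb k (Suc n) * \<gamma> x) =
      (\<lambda>x. cheb k (Suc (Suc n)) * \<beta> x + cheb k (Suc n) * \<gamma> x)"
    unfolding reflect_def 2 by (simp add: fun_eq_iff algebra_simps)
  ultimately show ?case using reflect_root[OF g] reflect_root[OF b] Suc by metis
qed

section \<open>Dominance, elementary roots and depth\<close>

definition dominates :: "('a \<Rightarrow> real) \<Rightarrow> ('a \<Rightarrow> real) \<Rightarrow> bool" where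
  "dominates \<beta> \<gamma> \<longleftrightarrow> (\<forall>w\<in>carrier W. \<beta> \<in> inversions w \<longrightarrow> \<gamma> \<in> inversions w)"

definition elementary :: "('a \<Rightarrow> real) set" where
  "elementary = {\<beta> \<in> pos_roots. \<forall>\<gamma>\<in>pos_roots. dominates \<beta> \<gamma> \<longrightarrow> \<gamma> = \<beta>}"

definition depth :: "('a \<Rightarrow> real) \<Rightarrow> nat" where
  "depth \<beta> = (LEAST n. \<exists>w\<in>carrier W. \<beta> \<in> inversions w \<and> len w = n)"

lemma depth_le: "w \<in> carrier W \<Longrightarrow> \<beta> \<in> inversions w \<Longrightarrow> depth \<beta> \<le> len w"
  unfolding depth_def by (rule Least_le) blast

lemma ex_depth:
  assumes "\<beta> \<in> pos_roots"
  shows "\<exists>w\<in>carrier W. \<beta> \<in> inversions w \<and> len w = depth \<beta>"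
proof -
  obtain v s where v: "v \<in> carrier W" "s \<in> S" "\<beta> = rho v (simple s)"
    using assms by (auto simp: pos_roots_def roots_def)
  have "rho (s \<otimes> inv v) \<beta> = (\<lambda>x. - simple s x)" using v by (simp add: rho_mult_apply rho_gen_simple)
  then have "\<beta> \<in> inversions (s \<otimes> inv v)" using assms by (simp add: inversions_def pos_simple)
  then have "\<exists>n. \<exists>w\<in>carrier W. \<beta> \<in> inversions w \<and> len w = n"
    using m_closed[OF gen_closed inv_closed] v by blast
  then show ?thesis unfolding depth_def by (rule LeastI_ex)
qed

lemma ex_left_descent:
  assumes w: "w \<in> carrier W" "w \<noteq> \<one>"
  shows "\<exists>s\<in>S. len w = Suc (len (s \<otimes> w))"
proof -
  have "inv w \<noteq> \<one>" using w by (metis inv_inv inv_one)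
  then obtain s where s: "s \<in> S" "len (inv w) = Suc (len (inv w \<otimes> s))"
    using ex_right_descent w by (metis inv_closed)
  have "len (s \<otimes> w) = len (inv w \<otimes> s)"
    using len_inv[of "s \<otimes> w"] w s by (simp add: inv_mult_group)
  then have "len w = Suc (len (s \<otimes> w))" using s w by simp
  then show ?thesis using s by blast
qed

text \<open>From a shortest \<open>w\<close> that makes \<open>\<beta>\<close> negative, remove a
  first letter \<open>r\<close>. The rest leaves \<open>\<beta>\<close>, and so
  \<open>\<gamma>\<close>, positive, while \<open>w\<close> makes both negative; hence the rest
  sends both to \<open>simple r\<close>.\<close>

lemma dominates_antisym:
  assumes b: "\<beta> \<in> pos_roots" and d1: "dominates \<beta> \<gamma>" and d2: "dominates \<gamma> \<beta>"
  shows "\<beta> = \<gamma>"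
proof -
  obtain w where w: "w \<in> carrier W" "\<beta> \<in> inversions w" "len w = depth \<beta>" using ex_depth[OF b] by blast
  then have "w \<noteq> \<one>" using inversions_one by auto
  then obtain r where r: "r \<in> S" "len w = Suc (len (r \<otimes> w))" using ex_left_descent w by blast
  let ?v = "r \<otimes> w"
  have v: "?v \<in> carrier W" "r \<otimes> ?v = w" using r w by auto
  have nb: "\<beta> \<notin> inversions ?v" using depth_le[OF v(1), of \<beta>] r w by auto
  then have ng: "\<gamma> \<notin> inversions ?v" using d2 v by (auto simp: dominates_def)
  have "\<gamma> \<in> inversions w" using d1 w by (auto simp: dominates_def)
  then have "rho ?v \<beta> = rho ?v \<gamma>"
    using inversions_gen_mult[OF v(1) r(1)] nb ng w v(2) by metis
  then show ?thesis using rho_inv_rho[OF v(1)] by metis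
qed

text \<open>The positive roots dominated by a given one are inversions of a single element, hence
  finite in number; passing to a different dominated root shrinks this set.\<close>

lemma dominates_elementary:
  assumes "\<beta> \<in> pos_roots"
  shows "\<exists>\<epsilon>\<in>elementary. dominates \<beta> \<epsilon>"
proof -
  define D where "D \<beta> = {\<gamma> \<in> pos_roots. dominates \<beta> \<gamma>}" for \<beta>
  have fin: "finite (D \<beta>)" if b: "\<beta> \<in> pos_roots" for \<beta>
  proof -
    obtain w where "w \<in> carrier W" "\<beta> \<in> inversions w" using ex_depth[OF b] by blast
    then show ?thesis using finite_inversions[of w] finite_subset[of "D \<beta>" "inversions w"]
      by (auto simp: D_def dominates_def)
  qed
  show ?thesis using assms
  proof (induction "card (D \<beta>)" arbitrary: \<beta> rule: less_induct)
    case less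
    show ?case
    proof (cases "\<beta> \<in> elementary")
      case True
      then show ?thesis by (auto simp: dominates_def)
    next
      case False
      then obtain \<gamma> where g: "\<gamma> \<in> pos_roots" "dominates \<beta> \<gamma>" "\<gamma> \<noteq> \<beta>"
        using less.prems by (auto simp: elementary_def)
      have "\<beta> \<notin> D \<gamma>" using dominates_antisym[OF less.prems g(2)] g(3) by (auto simp: D_def)
      moreover have "\<beta> \<in> D \<beta>" using less.prems by (simp add: D_def dominates_def)
      moreover have "D \<gamma> \<subseteq> D \<beta>" using g(2) by (auto simp: D_def dominates_def)
      ultimately have "card (D \<gamma>) < card (D \<beta>)"
        using fin[OF less.prems] by (intro psubset_card_mono) auto
      then obtain \<epsilon> where "\<epsilon> \<in> elementary" "dominates \<gamma> \<epsilon>" using less.hyps g(1) by blast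
      then show ?thesis using g(2) by (auto simp: dominates_def)
    qed
  qed
qed

text \<open>Otherwise some \<open>w\<close> makes only \<open>\<beta>\<close> negative and some
  \<open>u\<close> only \<open>\<gamma>\<close>. The infinitely many roots \<open>\<delta> n\<close>
  become positive under \<open>w\<close> and negative under \<open>u\<close>, so each is an
  inversion of \<open>u\<close> or the negative of an inversion of \<open>w\<close>, of which there
  are finitely many.\<close>

lemma dominates_total:
  assumes b: "\<beta> \<in> pos_roots" and g: "\<gamma> \<in> pos_roots" and k: "1 \<le> bil \<beta> \<gamma>" and ne: "\<beta> \<noteq> \<gamma>"
  shows "dominates \<beta> \<gamma> \<or> dominates \<gamma> \<beta>"
proof (rule ccontr)
  assume "\<not> ?thesis"
  then obtain w u where w: "w \<in> carrier W" "\<beta> \<in> inversions w" "\<gamma> \<notin> inversions w"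
    and u: "u \<in> carrier W" "\<gamma> \<in> inversions u" "\<beta> \<notin> inversions u" by (auto simp: dominates_def)
  define p where "p = cheb (bil \<beta> \<gamma>)"
  \<comment> \<open>These come from \<open>dihedral_roots\<close> for the pair
    \<open>- \<beta>\<close>, \<open>\<gamma>\<close>, whose form value is at most
    \<open>- 1\<close>, so that the coefficients grow strictly.\<close>
  define \<delta> where "\<delta> n = (\<lambda>x. p (Suc n) * - \<beta> x + p n * \<gamma> x)" for n
  have r: "\<beta> \<in> roots" "\<gamma> \<in> roots" using b g by (auto simp: pos_roots_def)
  have d: "\<delta> n \<in> roots" for n
    using dihedral_roots[OF minus_root[OF r(1)] r(2), of "bil \<beta> \<gamma>"] bil_minus_left
    by (simp add: \<delta>_def p_def)
  have inc: "0 \<le> p n" "p n + 1 \<le> p (Suc n)" for n using cheb_increasing[OF k] by (auto simp: p_def)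
  then have "strict_mono p" by (auto simp: strict_mono_Suc_iff intro: less_le_trans[OF _ inc(2)])
  then have inj_p: "p i = p j \<longleftrightarrow> i = j" for i j by (simp add: strict_mono_eq)
  have inj: "inj \<delta>"
  proof (rule injI, rule ccontr)
    fix i j assume e: "\<delta> i = \<delta> j" and ij: "i \<noteq> j"
    have "(p (Suc i) - p (Suc j)) * \<beta> x = (p i - p j) * \<gamma> x" for x
      using fun_cong[OF e, of x] by (simp add: \<delta>_def algebra_simps)
    moreover have "p (Suc i) - p (Suc j) \<noteq> 0" using inj_p[of "Suc i" "Suc j"] ij by simp
    ultimately show False using pos_root_proportional[OF b g] ne by blast
  qed
  have wd: "pos (rho w (\<delta> n))" for n
  proof -
    have e: "rho w (\<delta> n) = (\<lambda>x. p (Suc n) * - rho w \<beta> x + p n * rho w \<gamma> x)"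
      unfolding \<delta>_def using rho_comb[OF w(1), of "- p (Suc n)" \<beta> "p n" \<gamma>] by simp
    show ?thesis unfolding e
      using w not_inversionsD[OF g] order_trans[OF inc(1) order_trans[OF _ inc(2)]] inc(1)[of "Suc n"] inc(1)[of n]
      by (intro pos_comb) (auto simp: inversions_def pos_roots_def)
  qed
  have ud: "neg (rho u (\<delta> n))" for n
  proof -
    have e: "(\<lambda>x. - rho u (\<delta> n) x) = (\<lambda>x. p (Suc n) * rho u \<beta> x + p n * - rho u \<gamma> x)"
      unfolding \<delta>_def using rho_comb[OF u(1), of "- p (Suc n)" \<beta> "p n" \<gamma>] by simp
    show ?thesis unfolding neg_def e
      using u not_inversionsD[OF b] inc(1)[of "Suc n"] inc(1)[of n]
      by (intro pos_comb) (auto simp: inversions_def pos_roots_def)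
  qed
  have "\<delta> n \<in> inversions u \<union> (\<lambda>v x. - v x) ` inversions w" for n
  proof (cases "pos (\<delta> n)")
    case True
    then show ?thesis using d ud by (simp add: inversions_def pos_roots_def)
  next
    case False
    then have "neg (\<delta> n)" using d neg_iff_not_pos by blast
    then have "(\<lambda>x. - \<delta> n x) \<in> inversions w"
      using wd minus_root[OF d] w(1) by (simp add: inversions_def pos_roots_def rho_minus)
    then have "(\<lambda>x. - (- \<delta> n x)) \<in> (\<lambda>v x. - v x) ` inversions w" by (rule imageI)
    then show ?thesis by simp
  qed
  then have "range \<delta> \<subseteq> inversions u \<union> (\<lambda>v x. - v x) ` inversions w" by blast
  then have "finite (range \<delta>)"
    by (rule finite_subset) (simp add: finite_inversions u(1) w(1))
  then show False using range_inj_infinite[OF inj] by simp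
qed

subsection \<open>Values of the form on pairs of roots\<close>

definition linear_form :: "(('a \<Rightarrow> real) \<Rightarrow> real) \<Rightarrow> bool" where
  "linear_form f \<longleftrightarrow> (\<forall>a c u v. f (\<lambda>x. a * u x + c * v x) = a * f u + c * f v)"

lemma linear_formD: "linear_form f \<Longrightarrow> f (\<lambda>x. a * u x + c * v x) = a * f u + c * f v"
  by (simp add: linear_form_def)

lemma linear_form_minus: "linear_form f \<Longrightarrow> f (\<lambda>x. - v x) = - f v"
  using linear_formD[of f "- 1" v 0 v] by simp

lemma linear_form_rho: "linear_form f \<Longrightarrow> w \<in> carrier W \<Longrightarrow> linear_form (\<lambda>v. f (rho w v))"
  by (simp add: linear_form_def rho_comb)

lemma linear_form_sum:
  assumes f: "linear_form f" shows "finite A \<Longrightarrow> f (\<lambda>x. \<Sum>t\<in>A. c t * simple t x) = (\<Sum>t\<in>A. c t * f (simple t))"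
proof (induction A rule: finite_induct)
  case empty
  show ?case using linear_formD[OF f, of 0 undefined 0 undefined] by simp
next
  case (insert r A)
  have "f (\<lambda>x. c r * simple r x + 1 * (\<Sum>t\<in>A. c t * simple t x)) = c r * f (simple r) + 1 * f (\<lambda>x. \<Sum>t\<in>A. c t * simple t x)"
    by (rule linear_formD[OF f])
  then show ?case using insert by simp
qed

lemma linear_form_root:
  assumes f: "linear_form f" and b: "\<beta> \<in> roots"
  shows "f \<beta> = (\<Sum>t\<in>S. \<beta> t * f (simple t))"
proof -
  have "\<beta> = (\<lambda>x. \<Sum>t\<in>S. \<beta> t * simple t x)"
    using finite_S root_off[OF b] by (auto simp: simple_def fun_eq_iff if_distrib cong: if_cong)
  then show ?thesis using linear_form_sum[OF f finite_S, of \<beta>] by simp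
qed

text \<open>Reflecting at a simple root of negative value lowers the number of positive roots of
  negative value: the reflection permutes the positive roots other than \<open>simple s\<close>, and
  \<open>simple s\<close> itself is no longer counted.\<close>

lemma ex_dominant:
  assumes "linear_form f" "finite {\<delta> \<in> pos_roots. f \<delta> \<le> 0}"
  shows "\<exists>w\<in>carrier W. \<forall>s\<in>S. 0 \<le> f (rho w (simple s))"
  using assms
proof (induction "card {\<delta> \<in> pos_roots. f \<delta> < 0}" arbitrary: f rule: less_induct)
  case less
  show ?case
  proof (cases "\<forall>s\<in>S. 0 \<le> f (simple s)")
    case True
    then show ?thesis by (intro bexI[of _ \<one>]) auto
  next
    case False
    then obtain s where s: "s \<in> S" "f (simple s) < 0" by auto
    let ?f = "\<lambda>v. f (rho s v)"
    have gg: "rho s (rho s v) = v" for v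
      using s by (simp add: rho_gen reflect_reflect bil_simple_self)
    have fs: "?f (simple s) = - f (simple s)"
      using s linear_form_minus[OF less.prems(1)] by (simp add: rho_gen_simple)
    have lin: "linear_form ?f" using linear_form_rho[OF less.prems(1)] s by simp
    have "{\<delta> \<in> pos_roots. ?f \<delta> \<le> 0} \<subseteq> insert (simple s) (rho s ` {\<delta> \<in> pos_roots. f \<delta> \<le> 0})"
    proof
      fix \<delta> assume d: "\<delta> \<in> {\<delta> \<in> pos_roots. ?f \<delta> \<le> 0}"
      show "\<delta> \<in> insert (simple s) (rho s ` {\<delta> \<in> pos_roots. f \<delta> \<le> 0})"
      proof (cases "\<delta> = simple s")
        case False
        then have "rho s \<delta> \<in> {\<delta> \<in> pos_roots. f \<delta> \<le> 0}" using d s pos_rho_gen by simp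
        then show ?thesis using gg by (metis image_eqI insertI2)
      qed simp
    qed
    then have fin: "finite {\<delta> \<in> pos_roots. ?f \<delta> \<le> 0}"
      by (rule finite_subset) (simp add: less.prems(2))
    have sub: "rho s ` {\<delta> \<in> pos_roots. ?f \<delta> < 0} \<subseteq> {\<delta> \<in> pos_roots. f \<delta> < 0} - {simple s}"
    proof
      fix \<epsilon> assume "\<epsilon> \<in> rho s ` {\<delta> \<in> pos_roots. ?f \<delta> < 0}"
      then obtain \<delta> where d: "\<delta> \<in> pos_roots" "?f \<delta> < 0" "\<epsilon> = rho s \<delta>" by auto
      then have "\<delta> \<noteq> simple s" using fs s by auto
      then have "\<epsilon> \<in> pos_roots" using d s pos_rho_gen by blast
      moreover have "\<epsilon> \<noteq> simple s"
      proof
        assume "\<epsilon> = simple s"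
        then have "\<delta> = (\<lambda>x. - simple s x)" using gg[of \<delta>] d rho_gen_simple[OF s(1)] by simp
        then show False using pos_roots_not_neg[OF d(1)] by (simp add: pos_simple)
      qed
      ultimately show "\<epsilon> \<in> {\<delta> \<in> pos_roots. f \<delta> < 0} - {simple s}" using d by simp
    qed
    have finneg: "finite {\<delta> \<in> pos_roots. f \<delta> < 0}"
      by (rule finite_subset[OF _ less.prems(2)]) auto
    have "inj_on (rho s) {\<delta> \<in> pos_roots. ?f \<delta> < 0}"
      by (rule inj_on_inverseI[of _ "rho s"]) (rule gg)
    then have "card {\<delta> \<in> pos_roots. ?f \<delta> < 0} = card (rho s ` {\<delta> \<in> pos_roots. ?f \<delta> < 0})"
      by (rule card_image[symmetric])
    also have "\<dots> \<le> card ({\<delta> \<in> pos_roots. f \<delta> < 0} - {simple s})"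
      using sub finneg by (intro card_mono) auto
    also have "\<dots> < card {\<delta> \<in> pos_roots. f \<delta> < 0}"
      using s simple_pos_root finneg by (intro card_Diff1_less) auto
    finally obtain w where w: "w \<in> carrier W" "\<forall>r\<in>S. 0 \<le> ?f (rho w (simple r))"
      using less.hyps[OF _ lin fin] by blast
    then show ?thesis using s by (intro bexI[of _ "s \<otimes> w"]) (auto simp: rho_mult_apply)
  qed
qed

text \<open>For \<open>J \<subseteq> S\<close>, finiteness of this set stands in for finiteness of
  the standard parabolic subgroup generated by \<open>J\<close>.\<close>

definition roots_on :: "'a set \<Rightarrow> ('a \<Rightarrow> real) set" where
  "roots_on J = {\<beta> \<in> roots. \<forall>t. \<beta> t \<noteq> 0 \<longrightarrow> t \<in> J}"

lemma root_in_roots_on: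
  assumes f: "linear_form f" and nn: "\<forall>s\<in>S. 0 \<le> f (simple s)" and b: "\<beta> \<in> roots" and z: "f \<beta> = 0"
  shows "\<beta> \<in> roots_on {s \<in> S. f (simple s) = 0}"
proof -
  have pos: "\<forall>t\<in>S. \<gamma> t * f (simple t) = 0" if g: "\<gamma> \<in> roots" "pos \<gamma>" "f \<gamma> = 0" for \<gamma>
    using linear_form_root[OF f g(1)] g nn finite_S sum_nonneg_eq_0_iff[of S "\<lambda>t. \<gamma> t * f (simple t)"]
    by (simp add: pos_def)
  have "\<forall>t\<in>S. \<beta> t * f (simple t) = 0"
  proof (cases "pos \<beta>")
    case False
    then have "neg \<beta>" using neg_iff_not_pos b by blast
    then show ?thesis using pos[OF minus_root[OF b]] linear_form_minus[OF f] z by simp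
  qed (use pos b z in blast)
  then show ?thesis using b root_off[OF b] by (auto simp: roots_on_def)
qed

lemma pos_or_neg_by_coordinate:
  "\<delta> \<in> roots \<Longrightarrow> 0 < \<delta> t \<Longrightarrow> pos \<delta>" "\<delta> \<in> roots \<Longrightarrow> \<delta> t < 0 \<Longrightarrow> neg \<delta>"
  using root_pos_or_neg[of \<delta>] unfolding neg_def pos_def by (metis neg_0_le_iff_le not_less)+

text \<open>Otherwise the rotation by \<open>2 \<theta>\<close> would carry infinitely many positive roots of the plane
  to negative ones.\<close>

lemma angle_commensurable:
  assumes s: "s \<in> S" and g: "\<gamma> \<in> roots" and c: "bil (simple s) \<gamma> = - cos \<theta>"
    and \<theta>: "0 < \<theta>" "\<theta> \<le> pi / 2"
  shows "\<exists>k>0. sin (real k * \<theta>) = 0"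
proof (rule ccontr)
  assume "\<not> ?thesis"
  then have nz: "sin (real k * \<theta>) \<noteq> 0" if "0 < k" for k using that by blast
  have "\<theta> \<noteq> pi / 2"
  proof
    assume "\<theta> = pi / 2"
    then have "real 2 * \<theta> = pi" by simp
    then show False using nz[of 2] by (simp only: sin_pi) simp
  qed
  then have \<theta>2: "\<theta> < pi / 2" using \<theta> by simp
  have s0: "0 < sin \<theta>" using \<theta> by (intro sin_gt_zero) auto
  have c0: "0 < cos \<theta>" using \<theta> \<theta>2 by (intro cos_gt_zero) auto
  define p where "p = cheb (cos \<theta>)"
  have p_sin: "p n * sin \<theta> = sin (n * \<theta>)" for n unfolding p_def by (rule cheb_sin)
  define \<delta> where "\<delta> n = (\<lambda>x. p (Suc n) * simple s x + p n * \<gamma> x)" for n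
  have dr: "\<delta> n \<in> roots" for n
    using dihedral_roots[OF simple_root[OF s] g c] unfolding \<delta>_def p_def by blast
  let ?t = "root_reflection \<gamma>"
  have t: "?t \<in> carrier W" using root_reflection(1)[OF g] .
  \<comment> \<open>Reflecting in \<open>\<gamma>\<close> keeps the coefficient of
    \<open>simple s\<close> and moves that of \<open>\<gamma>\<close> from index \<open>n\<close> to
    \<open>n + 2\<close>.\<close>
  have td: "rho ?t (\<delta> n) = (\<lambda>x. p (Suc n) * simple s x + p (Suc (Suc n)) * \<gamma> x)" for n
  proof -
    have bd: "bil \<gamma> (\<delta> n) = p n - cos \<theta> * p (Suc n)"
      unfolding \<delta>_def bil_comb_right by (simp add: bil_sym[of \<gamma> "simple s"] c bil_root[OF g])
    show ?thesis unfolding root_reflection(2)[OF g] reflect_def bd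
      by (simp add: \<delta>_def p_def fun_eq_iff algebra_simps)
  qed
  have tr: "rho ?t (\<delta> n) \<in> roots" for n using rho_root[OF t dr] .
  \<comment> \<open>At a coordinate \<open>r \<noteq> s\<close> only \<open>\<gamma>\<close>
    contributes, so the signs of \<open>\<delta> n\<close> and of its image can be read off from
    \<open>p n\<close> and \<open>p (n + 2)\<close>.\<close>
  obtain r where r: "r \<noteq> s" "\<gamma> r \<noteq> 0"
  proof (cases "pos \<gamma>")
    case True
    then have "\<gamma> \<in> pos_roots" using g by (simp add: pos_roots_def)
    moreover have "\<gamma> \<noteq> simple s" using c c0 s bil_simple_self by fastforce
    ultimately show ?thesis using pos_root_coordinate[OF _ s] that by (metis less_irrefl)
  next
    case False
    then have m: "(\<lambda>x. - \<gamma> x) \<in> pos_roots" using g minus_root neg_iff_not_pos by (simp add: pos_roots_def)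
    have "(\<lambda>x. - \<gamma> x) \<noteq> simple s"
    proof
      assume "(\<lambda>x. - \<gamma> x) = simple s"
      then have "bil (simple s) (\<lambda>x. - \<gamma> x) = 1" using s by (simp add: bil_simple_self)
      then have "cos \<theta> = 1" using c by (simp add: bil_minus_right)
      then show False using s0 sin_cos_squared_add[of \<theta>] by simp
    qed
    then obtain r where "r \<noteq> s" "0 < - \<gamma> r" using pos_root_coordinate[OF m s] by blast
    then show ?thesis using that by auto
  qed
  have dr_r: "\<delta> n r = p n * \<gamma> r" "rho ?t (\<delta> n) r = p (Suc (Suc n)) * \<gamma> r" for n
    using r unfolding td by (simp_all add: \<delta>_def simple_def)
  define N where "N = {n. 0 < p n \<and> p (Suc (Suc n)) < 0}"
  have "\<delta> n \<in> inversions ?t \<union> (\<lambda>v x. - v x) ` inversions ?t" if n: "n \<in> N" for n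
  proof (cases "0 < \<gamma> r")
    case True
    then have "0 < \<delta> n r" "rho ?t (\<delta> n) r < 0" using n unfolding dr_r N_def by (auto simp: mult_neg_pos)
    then have "pos (\<delta> n)" "neg (rho ?t (\<delta> n))" using pos_or_neg_by_coordinate dr tr by blast+
    then show ?thesis using dr by (simp add: inversions_def pos_roots_def)
  next
    case False
    then have "\<gamma> r < 0" using r by simp
    then have "\<delta> n r < 0" "0 < rho ?t (\<delta> n) r" using n unfolding dr_r N_def by (auto simp: mult_pos_neg mult_neg_neg)
    then have "neg (\<delta> n)" "pos (rho ?t (\<delta> n))" using pos_or_neg_by_coordinate dr tr by blast+
    then have "(\<lambda>x. - \<delta> n x) \<in> inversions ?t"
      using minus_root[OF dr] t by (simp add: inversions_def pos_roots_def rho_minus)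
    then have "(\<lambda>x. - (- \<delta> n x)) \<in> (\<lambda>v x. - v x) ` inversions ?t" by (rule imageI)
    then show ?thesis by simp
  qed
  then have "\<delta> ` N \<subseteq> inversions ?t \<union> (\<lambda>v x. - v x) ` inversions ?t" by blast
  then have fin: "finite (\<delta> ` N)" by (rule finite_subset) (simp add: finite_inversions t)
  have "infinite N" unfolding infinite_nat_iff_unbounded
  proof
    fix k :: nat
    \<comment> \<open>The last multiple \<open>n * \<theta>\<close> up to the odd multiple
      \<open>y\<close> of \<open>pi\<close> has positive sine, while
      \<open>(n + 2) * \<theta>\<close> exceeds \<open>y\<close> by less than \<open>pi\<close> and
      has negative sine.\<close>
    define y where "y = real (2 * k + 1) * pi"
    define n where "n = nat \<lfloor>y / \<theta>\<rfloor>"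
    have "0 \<le> y / \<theta>" using \<theta> by (simp add: y_def)
    then have "real n \<le> y / \<theta>" "y / \<theta> < real n + 1" unfolding n_def by linarith+
    then have n: "real n * \<theta> \<le> y" "y < real n * \<theta> + \<theta>" using \<theta> by (simp_all add: field_simps)
    have y2: "y = 2 * real k * pi + pi" by (simp add: y_def algebra_simps)
    have "2 * real k * pi < real n * \<theta>" using n \<theta>2 y2 by simp
    moreover have "real k * \<theta> \<le> real k * (2 * pi)"
      using \<theta>2 pi_gt_zero by (intro mult_left_mono) linarith+
    moreover have "real k * (2 * pi) = 2 * real k * pi" by simp
    ultimately have "real k * \<theta> < real n * \<theta>" by linarith
    then have kn: "k < n" using \<theta> by simp
    have "sin (real n * \<theta>) = sin (real n * \<theta> - 2 * real k * pi)"
      using sin_diff[of "real n * \<theta>" "2 * real k * pi"] by simp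
    also have "\<dots> \<ge> 0" using \<open>2 * real k * pi < real n * \<theta>\<close> n y2 by (intro sin_ge_zero) auto
    finally have "0 < sin (real n * \<theta>)" using nz[of n] kn by (simp add: order_less_le)
    then have "0 < p n * sin \<theta>" by (simp only: p_sin)
    then have pn: "0 < p n" using s0 by (simp add: zero_less_mult_iff)
    have "- sin (real (Suc (Suc n)) * \<theta>) = sin (real (Suc (Suc n)) * \<theta> - y)"
      unfolding y2 by (simp add: sin_diff cos_add sin_add)
    also have "\<dots> > 0" using n \<theta> \<theta>2 by (intro sin_gt_zero) (auto simp: algebra_simps)
    finally have "p (Suc (Suc n)) * sin \<theta> < 0" by (simp only: p_sin)
    then have "p (Suc (Suc n)) < 0" using s0 by (simp add: mult_less_0_iff)
    then show "\<exists>n>k. n \<in> N" using kn pn by (auto simp: N_def)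
  qed
  then have "\<not> inj_on \<delta> N" using fin finite_imageD by blast
  then obtain i j where ij: "\<delta> i = \<delta> j" "i \<noteq> j" unfolding inj_on_def by blast
  \<comment> \<open>Equal roots give equal sines and cosines at \<open>i * \<theta>\<close> and
    \<open>j * \<theta>\<close>, so \<open>sin ((j - i) * \<theta>) = 0\<close>.\<close>
  have no: False if e: "\<delta> i = \<delta> j" and l: "i < j" for i j
  proof -
    have 1: "p i = p j" using fun_cong[OF e, of r] r unfolding dr_r by simp
    then have "p (Suc i) = p (Suc j)" using fun_cong[OF e, of s] by (simp add: \<delta>_def simple_def)
    then have "sin (real (Suc i) * \<theta>) = sin (real (Suc j) * \<theta>)" using p_sin by metis
    moreover have s1: "sin (real i * \<theta>) = sin (real j * \<theta>)" using 1 p_sin by metis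
    moreover have "sin (real (Suc n) * \<theta>) = sin (real n * \<theta>) * cos \<theta> + cos (real n * \<theta>) * sin \<theta>" for n
      using sin_add[of "real n * \<theta>" \<theta>] by (simp add: algebra_simps)
    ultimately have "cos (real i * \<theta>) * sin \<theta> = cos (real j * \<theta>) * sin \<theta>" by simp
    then have c1: "cos (real i * \<theta>) = cos (real j * \<theta>)" using s0 by simp
    have "real (j - i) * \<theta> = real j * \<theta> - real i * \<theta>" using l by (simp add: of_nat_diff algebra_simps)
    then have "sin (real (j - i) * \<theta>) = 0" by (simp add: sin_diff s1 c1)
    then show False using nz[of "j - i"] l by simp
  qed
  show False using no[of i j] no[of j i] ij by (metis linorder_neqE_nat)
qed

text \<open>The two reflections generate a finite dihedral group. Summing the coordinate sum over it
  gives a linear form that vanishes on both roots and is nonpositive at only finitely many positive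
  roots. Once some \<open>w\<close> makes it nonnegative on the simple roots, its zeros among the
  roots form the finite set \<open>roots_on J\<close>.\<close>

lemma nonpos_small_value_in_finite_parabolic:
  assumes s: "s \<in> S" and g: "\<gamma> \<in> roots" and c: "- 1 < bil (simple s) \<gamma>" "bil (simple s) \<gamma> \<le> 0"
  shows "\<exists>J\<subseteq>S. finite (roots_on J) \<and> (\<exists>w\<in>carrier W. rho w (simple s) \<in> roots_on J \<and> rho w \<gamma> \<in> roots_on J)"
proof -
  define \<theta> where "\<theta> = arccos (- bil (simple s) \<gamma>)"
  have cos: "bil (simple s) \<gamma> = - cos \<theta>" using c by (simp add: \<theta>_def cos_arccos)
  have \<theta>: "0 < \<theta>" "\<theta> \<le> pi / 2"
    using c arccos_lt_bounded[of "- bil (simple s) \<gamma>"] arccos_le_pi2[of "- bil (simple s) \<gamma>"] arccos_0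
      arccos_lbound[of "- bil (simple s) \<gamma>"]
    by (auto simp: \<theta>_def order_less_le dest: arccos_eq_0_iff[THEN iffD1, rotated])
  obtain k where k: "0 < k" "sin (real k * \<theta>) = 0" using angle_commensurable[OF s g cos \<theta>] by blast
  have sin: "sin \<theta> \<noteq> 0" using \<theta> sin_gt_zero[of \<theta>] by auto
  let ?t = "root_reflection \<gamma>"
  have t: "?t \<in> carrier W" using root_reflection(1)[OF g] .
  have sc: "s \<in> carrier W" using s by simp
  have rt: "rho ?t = reflect \<gamma>" using root_reflection(2)[OF g] by blast
  have "rho ((s \<otimes> ?t) [^] j) = (reflect (simple s) \<circ> reflect \<gamma>) ^^ j" for j :: nat
  proof (induction j)
    case (Suc j)
    then show ?case using sc t s by (simp add: rho_mult rt rho_gen funpow_Suc_right del: funpow.simps(2))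
  qed simp
  then have "rho ((s \<otimes> ?t) [^] k) v = v" for v
    using rotation_trivial[OF bil_simple_self[OF s] bil_root[OF g] cos sin k(2)] by simp
  then have pow: "(s \<otimes> ?t) [^] k = \<one>" using sc t by (intro rho_faithful) auto
  have "rho (?t \<otimes> ?t) v = v" for v using t by (simp add: rho_mult_apply rt reflect_reflect bil_root g)
  then have tt: "?t \<otimes> ?t = \<one>" using t by (intro rho_faithful) auto
  obtain D where D: "D \<subseteq> carrier W" "finite D" "D \<noteq> {}" "\<And>d. d \<in> D \<Longrightarrow> d \<otimes> s \<in> D \<and> d \<otimes> ?t \<in> D"
    using finite_right_closed_dihedral[OF sc t gen_square[OF s] tt k(1) pow] by blast
  \<comment> \<open>\<open>h\<close> is positive on every positive root, so among these
    \<open>f\<close> can fail to be positive only on inversions of elements of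
    \<open>D\<close>.\<close>
  define h where "h = (\<lambda>v::'a \<Rightarrow> real. \<Sum>t\<in>S. v t)"
  define f where "f = (\<lambda>v. \<Sum>d\<in>D. h (rho d v))"
  have h_comb: "h (\<lambda>x. a * u x + c * v x) = a * h u + c * h v" for a c u v
    by (simp add: h_def sum.distrib sum_distrib_left)
  have lin: "linear_form f" unfolding linear_form_def f_def
    using D(1) by (auto simp: rho_comb h_comb sum.distrib sum_distrib_left subset_iff intro!: sum.cong)
  have invariant: "f (rho a v) = f v" if a: "a \<in> carrier W" "a \<otimes> a = \<one>" "\<And>d. d \<in> D \<Longrightarrow> d \<otimes> a \<in> D" for a v
  proof -
    have inv: "d \<otimes> a \<otimes> a = d" if "d \<in> D" for d using a D(1) that by (auto simp: m_assoc)
    have "f (rho a v) = (\<Sum>d\<in>D. h (rho (d \<otimes> a) v))"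
      unfolding f_def using D(1) a(1) by (intro sum.cong) (auto simp: rho_mult_apply)
    also have "\<dots> = f v" unfolding f_def
      by (rule sum.reindex_bij_witness[of _ "\<lambda>d. d \<otimes> a" "\<lambda>d. d \<otimes> a"]) (auto simp: inv a)
    finally show ?thesis .
  qed
  \<comment> \<open>Invariance under a reflection forces \<open>f\<close> to vanish on its
    root.\<close>
  have "f (simple s) = - f (simple s)"
    using invariant[OF sc gen_square[OF s], of "simple s"] D(4) linear_form_minus[OF lin] by (simp add: rho_gen_simple s)
  then have fs: "f (simple s) = 0" by simp
  have "f \<gamma> = - f \<gamma>"
    using invariant[OF t tt, of \<gamma>] D(4) linear_form_minus[OF lin] by (simp add: rt reflect_self bil_root g)
  then have fg: "f \<gamma> = 0" by simp
  have h_pos: "0 < h \<delta>" if d: "\<delta> \<in> pos_roots" for \<delta>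
  proof -
    have nn: "\<forall>t. 0 \<le> \<delta> t" using d by (simp add: pos_roots_def pos_def)
    have "h \<delta> \<noteq> 0"
    proof
      assume "h \<delta> = 0"
      then have "\<forall>t\<in>S. \<delta> t = 0" using nn finite_S by (simp add: h_def sum_nonneg_eq_0_iff)
      then have "bil \<delta> \<delta> = 0" by (simp add: bil_def)
      then show False using bil_root d by (simp add: pos_roots_def)
    qed
    moreover have "0 \<le> h \<delta>" unfolding h_def using nn by (intro sum_nonneg) auto
    ultimately show ?thesis by simp
  qed
  have "{\<delta> \<in> pos_roots. f \<delta> \<le> 0} \<subseteq> (\<Union>d\<in>D. inversions d)"
  proof (rule subsetI, rule ccontr)
    fix \<delta> assume d: "\<delta> \<in> {\<delta> \<in> pos_roots. f \<delta> \<le> 0}" "\<delta> \<notin> (\<Union>d\<in>D. inversions d)"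
    have "0 < f \<delta>" unfolding f_def
    proof (rule sum_pos[OF D(2,3)])
      fix a assume "a \<in> D"
      then show "0 < h (rho a \<delta>)" using d D(1) by (intro h_pos not_inversionsD) auto
    qed
    then show False using d by simp
  qed
  then have fin: "finite {\<delta> \<in> pos_roots. f \<delta> \<le> 0}"
    by (rule finite_subset) (use D(1,2) finite_inversions in auto)
  then obtain w where w: "w \<in> carrier W" "\<forall>s\<in>S. 0 \<le> f (rho w (simple s))"
    using ex_dominant[OF lin] by blast
  let ?f = "\<lambda>v. f (rho w v)"
  let ?J = "{s \<in> S. ?f (simple s) = 0}"
  have lin': "linear_form ?f" using linear_form_rho[OF lin w(1)] .
  have iw: "inv w \<in> carrier W" using w by simp
  have m: "rho (inv w) \<beta> \<in> roots_on ?J" if "\<beta> \<in> roots" "f \<beta> = 0" for \<beta>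
    using root_in_roots_on[OF lin' w(2) rho_root[OF iw that(1)]] that w(1) by simp
  let ?P = "{\<delta> \<in> pos_roots. f \<delta> \<le> 0}"
  have "roots_on ?J \<subseteq> rho (inv w) ` (?P \<union> (\<lambda>v x. - v x) ` ?P)"
  proof
    fix \<delta> assume d: "\<delta> \<in> roots_on ?J"
    then have dr: "\<delta> \<in> roots" by (simp add: roots_on_def)
    have "(\<Sum>t\<in>S. \<delta> t * ?f (simple t)) = 0"
      using d by (intro sum.neutral) (auto simp: roots_on_def)
    then have z: "?f \<delta> = 0" using linear_form_root[OF lin' dr] by simp
    have wr: "rho w \<delta> \<in> roots" using rho_root[OF w(1) dr] .
    have "rho w \<delta> \<in> ?P \<union> (\<lambda>v x. - v x) ` ?P"
    proof (cases "pos (rho w \<delta>)")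
      case True
      then show ?thesis using wr z by (simp add: pos_roots_def)
    next
      case False
      then have "(\<lambda>x. - rho w \<delta> x) \<in> ?P"
        using wr z minus_root[OF wr] neg_iff_not_pos linear_form_minus[OF lin] by (simp add: pos_roots_def)
      then have "(\<lambda>x. - (- rho w \<delta> x)) \<in> (\<lambda>v x. - v x) ` ?P" by (rule imageI)
      then show ?thesis by simp
    qed
    then have "rho (inv w) (rho w \<delta>) \<in> rho (inv w) ` (?P \<union> (\<lambda>v x. - v x) ` ?P)" by (rule imageI)
    then show "\<delta> \<in> rho (inv w) ` (?P \<union> (\<lambda>v x. - v x) ` ?P)" using w(1) by simp
  qed
  then have "finite (roots_on ?J)" by (rule finite_subset) (simp add: fin)
  then show ?thesis using m[OF simple_root[OF s] fs] m[OF g fg] iw by (intro exI[of _ ?J]) auto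
qed

lemma minus_roots_on: "\<beta> \<in> roots_on J \<Longrightarrow> (\<lambda>x. - \<beta> x) \<in> roots_on J"
  by (auto simp: roots_on_def minus_root)

lemma small_value_in_finite_parabolic:
  assumes s: "s \<in> S" and g: "\<gamma> \<in> roots" and c: "\<bar>bil (simple s) \<gamma>\<bar> < 1"
  shows "\<exists>J\<subseteq>S. finite (roots_on J) \<and> (\<exists>\<beta>\<in>roots_on J. \<exists>\<delta>\<in>roots_on J. bil (simple s) \<gamma> = bil \<beta> \<delta>)"
proof (cases "bil (simple s) \<gamma> \<le> 0")
  case True
  then obtain J w where "J \<subseteq> S" "finite (roots_on J)" "w \<in> carrier W" "rho w (simple s) \<in> roots_on J" "rho w \<gamma> \<in> roots_on J"
    using nonpos_small_value_in_finite_parabolic[OF s g] c by auto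
  then show ?thesis using bil_rho[of w "simple s" \<gamma>] by metis
next
  case False
  then obtain J w where J: "J \<subseteq> S" "finite (roots_on J)" "w \<in> carrier W" "rho w (simple s) \<in> roots_on J"
      "rho w (\<lambda>x. - \<gamma> x) \<in> roots_on J"
    using nonpos_small_value_in_finite_parabolic[OF s minus_root[OF g]] c by (auto simp: bil_minus_right)
  then have "rho w \<gamma> \<in> roots_on J" using minus_roots_on[OF J(5)] by (simp add: rho_minus)
  then show ?thesis using bil_rho[of w "simple s" \<gamma>] J by metis
qed

definition small_values :: "real set" where
  "small_values = {bil (simple s) \<gamma> | s \<gamma>. s \<in> S \<and> \<gamma> \<in> roots \<and> \<bar>bil (simple s) \<gamma>\<bar> < 1}"

text \<open>Each small value occurs between two roots of a finite \<open>roots_on J\<close>, and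
  \<open>S\<close> has finitely many subsets \<open>J\<close>.\<close>

lemma finite_small_values: "finite small_values"
proof -
  let ?\<J> = "{J \<in> Pow S. finite (roots_on J)}"
  have "small_values \<subseteq> (\<Union>J\<in>?\<J>. (\<lambda>(\<beta>, \<delta>). bil \<beta> \<delta>) ` (roots_on J \<times> roots_on J))"
  proof
    fix y assume "y \<in> small_values"
    then obtain s \<gamma> where y: "s \<in> S" "\<gamma> \<in> roots" "\<bar>bil (simple s) \<gamma>\<bar> < 1" "y = bil (simple s) \<gamma>"
      by (auto simp: small_values_def)
    obtain J \<beta> \<delta> where J: "J \<subseteq> S" "finite (roots_on J)" "\<beta> \<in> roots_on J" "\<delta> \<in> roots_on J"
      "y = bil \<beta> \<delta>"
      using small_value_in_finite_parabolic[OF y(1-3)] y(4) by blast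
    then show "y \<in> (\<Union>J\<in>?\<J>. (\<lambda>(\<beta>, \<delta>). bil \<beta> \<delta>) ` (roots_on J \<times> roots_on J))"
      by (intro UN_I[of J] image_eqI[of _ _ "(\<beta>, \<delta>)"]) simp_all
  qed
  then show ?thesis by (rule finite_subset) (use finite_S in auto)
qed

subsection \<open>Finiteness of the set of elementary roots\<close>

lemma rho_gen_gen [simp]: "s \<in> S \<Longrightarrow> rho s (rho s v) = v"
  by (simp add: rho_gen reflect_reflect bil_simple_self)

lemma elementary_pos_root: "\<beta> \<in> elementary \<Longrightarrow> \<beta> \<in> pos_roots"
  by (simp add: elementary_def)

lemma elementary_eq_if_dominates: "\<beta> \<in> elementary \<Longrightarrow> \<gamma> \<in> pos_roots \<Longrightarrow> dominates \<beta> \<gamma> \<Longrightarrow> \<gamma> = \<beta>"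
  by (simp add: elementary_def)

text \<open>By \<open>dominates_total\<close> one of the two would dominate the other. If
  \<open>\<beta>\<close> does, it is not elementary; if \<open>simple s\<close> does, then
  \<open>s\<close> makes \<open>\<beta>\<close> negative, which it does to no positive root but
  \<open>simple s\<close>.\<close>

lemma bil_elementary_less_1:
  assumes b: "\<beta> \<in> elementary" and s: "s \<in> S" and ne: "\<beta> \<noteq> simple s"
  shows "bil (simple s) \<beta> < 1"
proof (rule ccontr)
  assume "\<not> bil (simple s) \<beta> < 1"
  then have "dominates (simple s) \<beta> \<or> dominates \<beta> (simple s)"
    using dominates_total[OF simple_pos_root[OF s] elementary_pos_root[OF b]] ne by auto
  moreover have "\<not> dominates \<beta> (simple s)"
    using elementary_eq_if_dominates[OF b simple_pos_root[OF s]] ne by blast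
  moreover have "\<not> dominates (simple s) \<beta>"
  proof
    assume d: "dominates (simple s) \<beta>"
    have "simple s \<in> inversions s" using s simple_pos_root by (simp add: inversions_def rho_gen_simple pos_simple)
    then have "neg (rho s \<beta>)" using d s by (simp add: dominates_def inversions_def)
    then show False using pos_rho_gen[OF elementary_pos_root[OF b] s ne] pos_roots_not_neg by blast
  qed
  ultimately show False by blast
qed

lemma rho_gen_apply: "s \<in> S \<Longrightarrow> rho s v = (\<lambda>x. v x - 2 * bil (simple s) v * simple s x)"
  by (simp add: rho_gen reflect_def)

text \<open>Take a shortest \<open>w\<close> making \<open>\<beta>\<close> negative. If
  \<open>s\<close> is a descent of \<open>w\<close>, the shorter \<open>w \<otimes> s\<close> makes
  \<open>rho s \<beta>\<close> negative; otherwise \<open>w\<close> does, since a positive multiple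
  of the positive root \<open>rho w (simple s)\<close> is subtracted.\<close>

lemma depth_rho_gen_le:
  assumes b: "\<beta> \<in> pos_roots" and s: "s \<in> S" and sb: "rho s \<beta> \<in> pos_roots" and B: "0 < bil (simple s) \<beta>"
  shows "depth (rho s \<beta>) \<le> depth \<beta>"
proof -
  obtain w where w: "w \<in> carrier W" "\<beta> \<in> inversions w" "len w = depth \<beta>" using ex_depth[OF b] by blast
  show ?thesis
  proof (cases "simple s \<in> inversions w")
    case True
    have "rho s \<beta> \<in> inversions (w \<otimes> s)" using w s sb by (simp add: inversions_def rho_mult_apply)
    then have "depth (rho s \<beta>) \<le> len (w \<otimes> s)" using w s by (intro depth_le) auto
    then show ?thesis using simple_inversion_descent[OF w(1) s True] w by simp
  next
    case False
    then have p: "pos (rho w (simple s))"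
      using not_inversionsD[OF simple_pos_root[OF s] w(1)] by (simp add: pos_roots_def)
    have n: "pos (\<lambda>x. - rho w \<beta> x)" using w(2) by (simp add: inversions_def)
    have "rho w (rho s \<beta>) = (\<lambda>x. 1 * rho w \<beta> x + (- 2 * bil (simple s) \<beta>) * rho w (simple s) x)"
      unfolding rho_gen_apply[OF s] using rho_comb[OF w(1), of 1 \<beta> "- 2 * bil (simple s) \<beta>" "simple s"] by simp
    then have "(\<lambda>x. - rho w (rho s \<beta>) x) =
        (\<lambda>x. 1 * - rho w \<beta> x + (2 * bil (simple s) \<beta>) * rho w (simple s) x)"
      by (simp add: fun_eq_iff)
    then have "pos (\<lambda>x. - rho w (rho s \<beta>) x)" using pos_comb[OF n p, of 1 "2 * bil (simple s) \<beta>"] B by simp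
    then have "rho s \<beta> \<in> inversions w" using sb by (simp add: inversions_def)
    then show ?thesis using depth_le[OF w(1)] w by metis
  qed
qed

text \<open>\<open>s\<close> is a right descent of a shortest \<open>w\<close> making
  \<open>\<beta>\<close> negative. A positive root dominated by \<open>rho s \<beta>\<close> is an
  inversion of \<open>w \<otimes> s\<close>, hence not \<open>simple s\<close>, and \<open>s\<close>
  carries it to a positive root dominated by \<open>\<beta>\<close>.\<close>

lemma elementary_descent:
  assumes b: "\<beta> \<in> elementary" and ns: "\<beta> \<notin> simple ` S"
  shows "\<exists>s\<in>S. rho s \<beta> \<in> elementary \<and> depth (rho s \<beta>) < depth \<beta> \<and>
    - 1 < bil (simple s) (rho s \<beta>) \<and> bil (simple s) (rho s \<beta>) < 0"
proof -
  have bp: "\<beta> \<in> pos_roots" using elementary_pos_root[OF b] .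
  obtain w where w: "w \<in> carrier W" "\<beta> \<in> inversions w" "len w = depth \<beta>" using ex_depth[OF bp] by blast
  then have "w \<noteq> \<one>" using inversions_one by auto
  then obtain s where s: "s \<in> S" "len w = Suc (len (w \<otimes> s))" using ex_right_descent w by blast
  let ?v = "w \<otimes> s"
  have v: "?v \<in> carrier W" "?v \<otimes> s = w" using w s by auto
  have ne: "\<beta> \<noteq> simple s" using ns s by blast
  have sbp: "rho s \<beta> \<in> pos_roots" using pos_rho_gen[OF bp s(1) ne] .
  have sbv: "rho s \<beta> \<in> inversions ?v" using w s sbp by (simp add: inversions_def rho_mult_apply)
  have dep: "depth (rho s \<beta>) < depth \<beta>" using depth_le[OF v(1) sbv] s w by simp
  have el: "rho s \<beta> \<in> elementary" unfolding elementary_def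
  proof (intro CollectI conjI ballI impI sbp)
    fix \<gamma> assume g: "\<gamma> \<in> pos_roots" and d: "dominates (rho s \<beta>) \<gamma>"
    have "\<gamma> \<in> inversions ?v" using d sbv v by (simp add: dominates_def)
    then have gs: "\<gamma> \<noteq> simple s" using simple_inversion_descent[OF v(1) s(1)] v(2) s(2) by auto
    then have sg: "rho s \<gamma> \<in> pos_roots" using pos_rho_gen[OF g s(1)] by blast
    have "dominates \<beta> (rho s \<gamma>)" unfolding dominates_def
    proof (intro ballI impI)
      fix x assume x: "x \<in> carrier W" "\<beta> \<in> inversions x"
      then have "rho s \<beta> \<in> inversions (x \<otimes> s)" using s sbp by (simp add: inversions_def rho_mult_apply)
      then have "\<gamma> \<in> inversions (x \<otimes> s)" using d x s by (simp add: dominates_def)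
      then show "rho s \<gamma> \<in> inversions x" using sg x s by (simp add: inversions_def rho_mult_apply)
    qed
    then have "rho s \<gamma> = \<beta>" using elementary_eq_if_dominates[OF b sg] by blast
    then show "\<gamma> = rho s \<beta>" using s by auto
  qed
  \<comment> \<open>This value lies between \<open>0\<close> and \<open>1\<close>: zero would fix
    \<open>\<beta>\<close>, a negative value contradicts \<open>depth_rho_gen_le\<close> at
    \<open>rho s \<beta>\<close>, and \<open>bil_elementary_less_1\<close> bounds it above.\<close>
  let ?B = "bil (simple s) \<beta>"
  have B: "bil (simple s) (rho s \<beta>) = - ?B"
    using s by (simp add: rho_gen bil_reflect_right bil_simple_self)
  have "?B \<noteq> 0"
  proof
    assume "?B = 0"
    then have "rho s \<beta> = \<beta>" using s by (simp add: rho_gen_apply)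
    then show False using dep by simp
  qed
  moreover have "\<not> ?B < 0"
  proof
    assume "?B < 0"
    then have "depth (rho s (rho s \<beta>)) \<le> depth (rho s \<beta>)"
      using B s bp sbp by (intro depth_rho_gen_le) auto
    then show False using dep s by simp
  qed
  moreover have "?B < 1" using bil_elementary_less_1[OF b s(1) ne] .
  ultimately show ?thesis using s el dep B by (intro bexI[of _ s]) auto
qed

definition elementary_chain :: "nat \<Rightarrow> (nat \<Rightarrow> 'a \<Rightarrow> real) \<Rightarrow> (nat \<Rightarrow> 'a) \<Rightarrow> bool" where
  "elementary_chain n f r \<longleftrightarrow> f 0 \<in> simple ` S \<and> (\<forall>i\<le>n. f i \<in> elementary) \<and>
    (\<forall>i<n. r i \<in> S \<and> f (Suc i) = rho (r i) (f i) \<and> depth (f i) < depth (f (Suc i)) \<and>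
      - 1 < bil (simple (r i)) (f i) \<and> bil (simple (r i)) (f i) < 0)"

lemma ex_elementary_chain:
  "\<beta> \<in> elementary \<Longrightarrow> \<exists>n f r. elementary_chain n f r \<and> f n = \<beta>"
proof (induction "depth \<beta>" arbitrary: \<beta> rule: less_induct)
  case less
  show ?case
  proof (cases "\<beta> \<in> simple ` S")
    case True
    then have "elementary_chain 0 (\<lambda>_. \<beta>) undefined" using less.prems by (simp add: elementary_chain_def)
    then show ?thesis by metis
  next
    case False
    then obtain s where s: "s \<in> S" "rho s \<beta> \<in> elementary" "depth (rho s \<beta>) < depth \<beta>"
      "- 1 < bil (simple s) (rho s \<beta>)" "bil (simple s) (rho s \<beta>) < 0"
      using elementary_descent[OF less.prems] by blast
    then obtain n f r where c: "elementary_chain n f r" "f n = rho s \<beta>" using less.hyps by blast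
    have "elementary_chain (Suc n) (f(Suc n := \<beta>)) (r(n := s))"
      unfolding elementary_chain_def
    proof (intro conjI allI impI)
      show "(f(Suc n := \<beta>)) 0 \<in> simple ` S" using c(1) by (simp add: elementary_chain_def)
    next
      fix i assume "i \<le> Suc n"
      then show "(f(Suc n := \<beta>)) i \<in> elementary"
        using c(1) less.prems by (auto simp: elementary_chain_def le_Suc_eq)
    next
      fix i assume i: "i < Suc n"
      show "(r(n := s)) i \<in> S" "(f(Suc n := \<beta>)) (Suc i) = rho ((r(n := s)) i) ((f(Suc n := \<beta>)) i)"
        "depth ((f(Suc n := \<beta>)) i) < depth ((f(Suc n := \<beta>)) (Suc i))"
        "- 1 < bil (simple ((r(n := s)) i)) ((f(Suc n := \<beta>)) i)"
        "bil (simple ((r(n := s)) i)) ((f(Suc n := \<beta>)) i) < 0"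
        using i c s by (auto simp: elementary_chain_def less_Suc_eq)
    qed
    then show ?thesis by (intro exI[of _ "Suc n"] exI[of _ "f(Suc n := \<beta>)"] exI[of _ "r(n := s)"]) simp
  qed
qed

text \<open>On elementary non-simple roots, \<open>None\<close> stands for a value at most \<open>- 1\<close>.\<close>

definition truncation :: "('a \<Rightarrow> real) \<Rightarrow> 'a \<Rightarrow> real option" where
  "truncation \<gamma> = (\<lambda>s\<in>S. if \<bar>bil (simple s) \<gamma>\<bar> < 1 then Some (bil (simple s) \<gamma>) else None)"

definition truncations :: "('a \<Rightarrow> real option) set" where
  "truncations = S \<rightarrow>\<^sub>E insert None (Some ` small_values)"

lemma finite_truncations: "finite truncations"
  unfolding truncations_def using finite_S finite_small_values by (intro finite_PiE) auto

lemma truncation_in: "\<gamma> \<in> roots \<Longrightarrow> truncation \<gamma> \<in> truncations"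
  unfolding truncation_def truncations_def small_values_def by (intro PiE_I) auto

lemma elementary_chain_depth:
  assumes c: "elementary_chain n f r" and "j \<le> n" "i < j"
  shows "depth (f i) < depth (f j)"
  using assms(2,3)
proof (induction j)
  case (Suc j)
  then have "depth (f j) < depth (f (Suc j))" using c unfolding elementary_chain_def by (metis Suc_le_lessD)
  then show ?case using Suc by (cases "i = j") auto
qed simp

text \<open>While the value at \<open>s\<close> is at most \<open>- 1\<close>, no step uses
  \<open>s\<close>, so the coordinate stays; the other steps never raise the value, as the
  off-diagonal coefficients are nonpositive.\<close>

lemma elementary_chain_frozen:
  assumes c: "elementary_chain n f r" and s: "s \<in> S" "bil (simple s) (f i) \<le> - 1"
    and k: "i + k \<le> n"
  shows "bil (simple s) (f (i + k)) \<le> - 1 \<and> f (i + k) s = f i s"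
  using k
proof (induction k)
  case (Suc k)
  let ?j = "i + k"
  have IH: "bil (simple s) (f ?j) \<le> - 1" "f ?j s = f i s" using Suc by auto
  have j: "r ?j \<in> S" "f (Suc ?j) = rho (r ?j) (f ?j)" "- 1 < bil (simple (r ?j)) (f ?j)"
    "bil (simple (r ?j)) (f ?j) < 0"
    using c Suc.prems by (auto simp: elementary_chain_def)
  have ne: "s \<noteq> r ?j" using IH j by auto
  have "f (Suc ?j) s = f ?j s" using ne j by (simp add: rho_gen_apply simple_def)
  moreover have "bil (simple s) (f (Suc ?j)) =
      bil (simple s) (f ?j) - 2 * bil (simple (r ?j)) (f ?j) * form_coeff s (r ?j)"
    using j s by (simp add: rho_gen bil_reflect_right bil_simple)
  moreover have "0 \<le> bil (simple (r ?j)) (f ?j) * form_coeff s (r ?j)"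
    using form_coeff_off_diag[OF s(1) j(1) ne] j(4) by (intro mult_nonpos_nonpos) auto
  ultimately show ?case using IH by simp
qed (use s in auto)

lemma elementary_chain_length:
  assumes c: "elementary_chain n f r"
  shows "n \<le> card truncations"
proof (rule ccontr)
  assume "\<not> n \<le> card truncations"
  then have n: "card truncations < n" by simp
  have el: "f i \<in> elementary" if "i \<le> n" for i using c that by (simp add: elementary_chain_def)
  have rt: "f i \<in> roots" if "i \<le> n" for i
    using elementary_pos_root[OF el[OF that]] by (simp add: pos_roots_def)
  \<comment> \<open>Indices start at \<open>1\<close> because \<open>f 0\<close> is simple; later
    roots have depth above \<open>1\<close>, so they are not simple and all their values are below
    \<open>1\<close>.\<close>
  have "\<not> inj_on (\<lambda>i. truncation (f i)) {1..n}"
  proof (rule pigeonhole)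
    have "(\<lambda>i. truncation (f i)) ` {1..n} \<subseteq> truncations" using truncation_in rt by auto
    then have "card ((\<lambda>i. truncation (f i)) ` {1..n}) \<le> card truncations"
      by (rule card_mono[OF finite_truncations])
    then show "card ((\<lambda>i. truncation (f i)) ` {1..n}) < card {1..n}" using n by simp
  qed
  then obtain i j where ij: "1 \<le> i" "i < j" "j \<le> n" "truncation (f i) = truncation (f j)"
    unfolding inj_on_def by (metis atLeastAtMost_iff linorder_neqE_nat)
  have f0: "0 < depth (f 0)"
  proof (rule ccontr)
    assume z: "\<not> 0 < depth (f 0)"
    obtain w where "w \<in> carrier W" "f 0 \<in> inversions w" "len w = depth (f 0)"
      using ex_depth[OF elementary_pos_root[OF el]] by blast
    then show False using z len_zero[of w] inversions_one by auto
  qed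
  have "f i \<noteq> simple s" if s: "s \<in> S" for s
  proof
    assume e: "f i = simple s"
    have "simple s \<in> inversions s" using s simple_pos_root by (simp add: inversions_def rho_gen_simple pos_simple)
    then have "depth (f i) \<le> 1" using depth_le[of s "f i"] s len_gen by (simp add: e)
    then show False using elementary_chain_depth[OF c, of i 0] ij f0 by simp
  qed
  then have lt: "bil (simple s) (f i) < 1" if "s \<in> S" for s
    using bil_elementary_less_1[OF el] ij that by simp
  \<comment> \<open>At each \<open>s\<close> either the coordinate is frozen and
    \<open>?D s = 0\<close>, or both values agree and \<open>?D\<close> is orthogonal to
    \<open>simple s\<close>. So \<open>?D\<close> is isotropic.\<close>
  let ?D = "\<lambda>x. 1 * f j x + - 1 * f i x"
  have "?D s * bil (simple s) ?D = 0" if s: "s \<in> S" for s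
  proof (cases "bil (simple s) (f i) \<le> - 1")
    case True
    then show ?thesis using elementary_chain_frozen[OF c s True, of "j - i"] ij by simp
  next
    case False
    then have a: "\<bar>bil (simple s) (f i)\<bar> < 1" using lt[OF s] by simp
    have "truncation (f i) s = truncation (f j) s" using ij(4) by simp
    then have "bil (simple s) (f j) = bil (simple s) (f i)"
      using s a by (auto simp: truncation_def split: if_splits)
    then show ?thesis by (simp only: bil_comb_right)  simp
  qed
  then have "bil ?D ?D = 0" unfolding bil_expand[of ?D] by (rule sum.neutral[OF ballI])
  then have "bil (f i) (f j) = 1" unfolding bil_comb_left bil_comb_right
    using bil_root[OF rt, of i] bil_root[OF rt, of j] ij bil_sym[of "f i" "f j"] by simp
  moreover have ne: "f i \<noteq> f j" using elementary_chain_depth[OF c ij(3,2)] by auto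
  ultimately have "dominates (f i) (f j) \<or> dominates (f j) (f i)"
    using dominates_total[OF elementary_pos_root[OF el] elementary_pos_root[OF el], of i j] ij by simp
  then show False
    using elementary_eq_if_dominates el elementary_pos_root ne ij by (metis order.trans less_imp_le)
qed

text \<open>Chains have bounded length, so every elementary root arises from a simple root by a word
  of bounded length in \<open>S\<close>.\<close>

theorem finite_elementary: "finite elementary"
proof -
  let ?K = "card truncations"
  let ?A = "{ws. set ws \<subseteq> S \<and> length ws \<le> ?K} \<times> S"
  have "elementary \<subseteq> (\<lambda>(ws, s). act ws (simple s)) ` ?A"
  proof
    fix \<beta> assume "\<beta> \<in> elementary"
    then obtain n f r where c: "elementary_chain n f r" "f n = \<beta>" using ex_elementary_chain by blast
    have "i \<le> n \<Longrightarrow> \<exists>ws. set ws \<subseteq> S \<and> length ws = i \<and> f i = act ws (f 0)" for i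
    proof (induction i)
      case (Suc i)
      then obtain ws where "set ws \<subseteq> S" "length ws = i" "f i = act ws (f 0)" by auto
      moreover have "r i \<in> S" "f (Suc i) = rho (r i) (f i)"
        using c Suc.prems by (auto simp: elementary_chain_def)
      ultimately show ?case by (intro exI[of _ "r i # ws"]) (simp add: rho_gen)
    qed simp
    then obtain ws where ws: "set ws \<subseteq> S" "length ws = n" "f n = act ws (f 0)" by blast
    obtain s where "s \<in> S" "f 0 = simple s" using c by (auto simp: elementary_chain_def)
    then show "\<beta> \<in> (\<lambda>(ws, s). act ws (simple s)) ` ?A"
      using ws c elementary_chain_length[OF c(1)] by (intro image_eqI[of _ _ "(ws, s)"]) auto
  qed
  then show ?thesis
    by (rule finite_subset) (use finite_S finite_lists_length_le in blast)
qed

subsection \<open>Cone types and palindromes\<close>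

definition cone :: "'a list \<Rightarrow> 'a list set" where
  "cone u = {v \<in> lists S. reduced_word W S (u @ v)}"

text \<open>A root common to both inversion sets dominates an elementary root, which then also lies
  in both.\<close>

lemma reduced_append_iff_elementary:
  assumes u: "reduced_word W S u" and v: "reduced_word W S v"
  shows "reduced_word W S (u @ v) \<longleftrightarrow> (inversions (val u) \<inter> elementary) \<inter> inversions (inv (val v)) = {}"
proof -
  have c: "val u \<in> carrier W" "val v \<in> carrier W" using u v by (auto simp: reduced_word_def)
  have "reduced_word W S (u @ v) \<longleftrightarrow> inversions (val u) \<inter> inversions (inv (val v)) = {}"
    using reduced_word_append_iff[OF u v] len_mult_iff[OF c] by simp
  also have "\<dots> \<longleftrightarrow> (inversions (val u) \<inter> elementary) \<inter> inversions (inv (val v)) = {}"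
  proof
    assume e: "(inversions (val u) \<inter> elementary) \<inter> inversions (inv (val v)) = {}"
    show "inversions (val u) \<inter> inversions (inv (val v)) = {}"
    proof (rule ccontr)
      assume "\<not> ?thesis"
      then obtain \<beta> where b: "\<beta> \<in> inversions (val u)" "\<beta> \<in> inversions (inv (val v))" by blast
      obtain \<epsilon> where "\<epsilon> \<in> elementary" "dominates \<beta> \<epsilon>"
        using dominates_elementary[OF inversions_pos_root[OF b(1)]] by blast
      then show False using e b c by (auto simp: dominates_def)
    qed
  qed blast
  finally show ?thesis .
qed

text \<open>The cone of \<open>u\<close> depends only on the elementary inversions of
  \<open>u\<close>, a subset of the finite set \<open>elementary\<close>.\<close>

lemma finite_cones: "finite (cone ` {u. reduced_word W S u})"
proof -
  let ?h = "\<lambda>E. {v. reduced_word W S v \<and> E \<inter> inversions (inv (val v)) = {}}"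
  have "cone ` {u. reduced_word W S u} \<subseteq> ?h ` Pow elementary"
  proof
    fix C assume "C \<in> cone ` {u. reduced_word W S u}"
    then obtain u where u: "reduced_word W S u" "C = cone u" by blast
    have "cone u = ?h (inversions (val u) \<inter> elementary)"
    proof (rule Set.set_eqI)
      fix v
      show "v \<in> cone u \<longleftrightarrow> v \<in> ?h (inversions (val u) \<inter> elementary)"
      proof (cases "reduced_word W S v")
        case True
        then show ?thesis
          using reduced_append_iff_elementary[OF u(1) True] by (simp add: cone_def reduced_word_lists)
      next
        case False
        then show ?thesis using reduced_word_append(2)[of u v] by (auto simp: cone_def)
      qed
    qed
    then show "C \<in> ?h ` Pow elementary" using u by blast
  qed
  then show ?thesis by (rule finite_subset) (simp add: finite_elementary)
qed

lemma coneI: "reduced_word W S (u @ v) \<Longrightarrow> v \<in> cone u"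
  using reduced_word_lists[of "u @ v"] by (simp add: cone_def)

lemma coneD: "v \<in> cone u \<Longrightarrow> reduced_word W S (u @ v)"
  by (simp add: cone_def)

lemma cone_append: "x \<in> lists S \<Longrightarrow> cone (u @ x) = {v \<in> lists S. x @ v \<in> cone u}"
  by (auto simp: cone_def)

section \<open>Palindromic words for reflections\<close>

lemma reduced_palindrome_cone:
  assumes c: "cone u = cone v" and r: "reduced_word W S (u @ [s] @ rev u)"
  shows "reduced_word W S (v @ [s] @ rev v)"
proof -
  \<comment> \<open>The left half is exchanged, the word is reversed, and the new left half is
    exchanged as well.\<close>
  have "reduced_word W S (v @ [s] @ rev u)" using coneI[OF r] coneD c by metis
  then have "reduced_word W S (rev (v @ [s] @ rev u))" by (simp only: reduced_word_rev)
  then have "reduced_word W S (u @ [s] @ rev v)" by simp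
  then show ?thesis using coneI coneD c by metis
qed

text \<open>When the word is read from right to left, \<open>s\<close> is a letter at which
  \<open>\<beta>\<close> turns negative; a simple reflection does this to no positive root but its
  own.\<close>

lemma inversion_split:
  assumes "xs \<in> lists S" "\<beta> \<in> inversions (val xs)"
  shows "\<exists>us s vs. xs = us @ [s] @ vs \<and> rho (val vs) \<beta> = simple s"
  using assms
proof (induction xs)
  case (Cons a ys)
  have S: "a \<in> S" "ys \<in> lists S" using Cons.hyps by auto
  show ?case
  proof (cases "\<beta> \<in> inversions (val ys)")
    case True
    then obtain us s vs where "ys = us @ [s] @ vs" "rho (val vs) \<beta> = simple s" using Cons by auto
    then show ?thesis by (intro exI[of _ "a # us"] exI[of _ s] exI[of _ vs]) simp
  next
    case False
    then have "rho (val ys) \<beta> = simple a"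
      using inversions_gen_mult[of "val ys" a \<beta>] Cons.prems S by simp
    then show ?thesis by (intro exI[of _ "[]"] exI[of _ a] exI[of _ ys]) simp
  qed
qed (simp add: inversions_one)

text \<open>A reflection negates its root \<open>\<beta>\<close>, which is therefore an inversion.
  If \<open>s\<close> is the letter at which \<open>\<beta>\<close> turns negative,
  \<open>vs\<close> conjugates the reflection into \<open>s\<close>, which forces
  \<open>val vs\<close> to be the inverse of \<open>val us\<close>.\<close>

lemma reduced_reflection_word:
  assumes r: "reduced_word W S xs" and t: "val xs \<in> reflections W S"
  shows "\<exists>us s vs. xs = us @ [s] @ vs \<and> length us = length vs \<and> val vs = val (rev us)"
proof -
  obtain w s where w: "w \<in> carrier W" "s \<in> S" "val xs = w \<otimes> s \<otimes> inv w"
    using t by (auto simp: reflections_def)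
  define \<beta> where "\<beta> = pos_part (rho w (simple s))"
  have \<beta>: "\<beta> = rho w (simple s) \<or> \<beta> = (\<lambda>x. - rho w (simple s) x)" by (simp add: \<beta>_def pos_part_def)
  have wr: "rho w (simple s) \<in> roots" using rootI w by blast
  then have bp: "\<beta> \<in> pos_roots"
    using minus_root neg_iff_not_pos by (auto simp: \<beta>_def pos_part_def pos_roots_def)
  have "rho (val xs) \<beta> = reflect \<beta> \<beta>" using \<beta> w by (auto simp: rho_conjugate reflect_minus_left)
  then have "\<beta> \<in> inversions (val xs)"
    using bp bil_root by (simp add: inversions_def reflect_self pos_roots_def)
  then obtain us a vs where xs: "xs = us @ [a] @ vs" "rho (val vs) \<beta> = simple a"
    using inversion_split reduced_word_lists[OF r] by blast
  have l: "us \<in> lists S" "a \<in> S" "vs \<in> lists S" using reduced_word_lists[OF r] xs by auto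
  let ?z = "val vs"
  have z: "?z \<in> carrier W" using l by simp
  have "rho (?z \<otimes> w) (simple s) = simple a \<or> rho (?z \<otimes> w) (simple s) = (\<lambda>x. - simple a x)"
    using \<beta>
  proof
    assume "\<beta> = (\<lambda>x. - rho w (simple s) x)"
    then have "rho w (simple s) = (\<lambda>x. - \<beta> x)" by simp
    then show ?thesis using xs(2) w z by (simp add: rho_mult_apply rho_minus)
  qed (use xs(2) w z in \<open>simp add: rho_mult_apply\<close>)
  then have "?z \<otimes> w \<otimes> s \<otimes> inv (?z \<otimes> w) = a" using conjugate_eq_gen[of "?z \<otimes> w" s a] z w l by simp
  then have "?z \<otimes> val xs \<otimes> inv ?z = a" using z w by (simp add: inv_mult_group m_assoc)
  moreover have "val xs = val us \<otimes> a \<otimes> ?z" using l by (simp add: xs(1) val_append m_assoc)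
  ultimately have e: "?z \<otimes> val us \<otimes> a = a" using z l by (simp add: m_assoc)
  have "?z \<otimes> val us = ?z \<otimes> val us \<otimes> a \<otimes> a" using z l by simp
  also have "\<dots> = \<one>" unfolding e using l by simp
  finally have zu: "?z = val (rev us)" using z l by (simp add: val_rev inv_equality[symmetric])
  have "reduced_word W S us" "reduced_word W S vs"
    using r reduced_word_append[of us "[a] @ vs"] reduced_word_append(2)[of "us @ [a]" vs] by (simp_all add: xs(1))
  then have "length us = length vs" using zu l by (simp add: reduced_word_def val_rev)
  then show ?thesis using xs(1) zu by blast
qed

lemma val_palindrome:
  assumes "us \<in> lists S" "s \<in> S"
  shows "val (us @ [s] @ rev us) = val us \<otimes> s \<otimes> inv (val us)"
  using assms by (simp add: val_append val_rev m_assoc)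

lemma val_palindrome_reflection:
  assumes "us \<in> lists S" "s \<in> S"
  shows "val (us @ [s] @ rev us) \<in> reflections W S"
  unfolding val_palindrome[OF assms] reflections_def using assms val_closed by blast

text \<open>A reduced word of a prefix extends to one of its reflection. The middle letter is the
  last letter of \<open>ws\<close>, because \<open>length ws = k + 1\<close>, and the letters after
  it may be replaced by \<open>rev us\<close>, which has the same product.\<close>

lemma Pref_iff: "ws \<in> Pref W S \<longleftrightarrow> (\<exists>us s. ws = us @ [s] \<and> reduced_word W S (us @ [s] @ rev us))"
proof
  assume "ws \<in> Pref W S"
  then obtain t k where ws: "reduced_word W S ws" and t: "t \<in> reflections W S"
    and le: "weak_le W S (val ws) t" and k: "len t = 2 * k + 1" "len (val ws) = k + 1"
    by (auto simp: Pref_def reflection_prefix_def t_prefix_def)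
  have lw: "length ws = k + 1" "ws \<in> lists S" using ws k by (auto simp: reduced_word_def)
  have tc: "t \<in> carrier W" using t by (auto simp: reflections_def)
  obtain v where v: "reduced_word W S v" "val v = inv (val ws) \<otimes> t"
    using ex_reduced_word[of "inv (val ws) \<otimes> t"] tc lw by auto
  have vS: "v \<in> lists S" "length v = k"
    using v le k by (auto simp: reduced_word_def weak_le_def)
  have vt: "val (ws @ v) = t" using vS lw tc v by (simp add: val_append m_assoc[symmetric])
  then have "reduced_word W S (ws @ v)" using vS lw k by (auto simp: reduced_word_def)
  then obtain us s vs where us: "ws @ v = us @ [s] @ vs" "length us = length vs" "val vs = val (rev us)"
    using reduced_reflection_word t vt by metis
  have "length us = k" using arg_cong[OF us(1), of length] lw vS us(2) by simp
  then have eq: "ws = us @ [s]" "v = vs"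
    using us(1) lw append_eq_append_conv[of ws "us @ [s]" v vs] by auto
  have S: "us \<in> lists S" "s \<in> S" using lw eq by auto
  have "val (us @ [s] @ rev us) = t" using us eq vt S vS by (simp add: val_append)
  then have "reduced_word W S (us @ [s] @ rev us)"
    using S k \<open>length us = k\<close> by (simp add: reduced_word_def del: append.simps)
  then show "\<exists>us s. ws = us @ [s] \<and> reduced_word W S (us @ [s] @ rev us)" using eq by blast
next
  assume "\<exists>us s. ws = us @ [s] \<and> reduced_word W S (us @ [s] @ rev us)"
  then obtain us s where ws: "ws = us @ [s]" and r: "reduced_word W S (us @ [s] @ rev us)" by blast
  have S: "us \<in> lists S" "s \<in> S" using reduced_word_lists[OF r] by auto
  let ?t = "val (us @ [s] @ rev us)"
  have rw: "reduced_word W S ws" "reduced_word W S (rev us)"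
    using r reduced_word_append[of ws "rev us"] by (simp_all add: ws)
  have tt: "?t = val ws \<otimes> val (rev us)" using S by (simp add: ws val_append m_assoc)
  have pc: "val ws \<in> carrier W" "val (rev us) \<in> carrier W"
    using rw reduced_word_lists val_closed by blast+
  have "inv (val ws) \<otimes> ?t = val (rev us)" using pc unfolding tt by (simp add: m_assoc[symmetric])
  then have "t_prefix W S ?t (val ws)"
    using reduced_wordD[OF r] reduced_wordD[OF rw(1)] reduced_wordD[OF rw(2)] pc(1)
    unfolding t_prefix_def weak_le_def by (auto simp: ws)
  then show "ws \<in> Pref W S"
    using rw(1) val_palindrome_reflection[OF S] unfolding Pref_def reflection_prefix_def by blast
qed

lemma Pal_iff: "ws \<in> Pal W S \<longleftrightarrow> (\<exists>us s. ws = us @ [s] @ rev us \<and> reduced_word W S (us @ [s] @ rev us))"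
proof
  assume "ws \<in> Pal W S"
  then have r: "reduced_word W S ws" and t: "val ws \<in> reflections W S" and p: "rev ws = ws"
    by (auto simp: Pal_def)
  obtain us s vs where us: "ws = us @ [s] @ vs" "length us = length vs"
    using reduced_reflection_word[OF r t] by blast
  then have "vs = rev us" using p append_eq_append_conv[of "rev vs" us "[s] @ rev us" "[s] @ vs"] by auto
  then show "\<exists>us s. ws = us @ [s] @ rev us \<and> reduced_word W S (us @ [s] @ rev us)" using us r by blast
next
  assume "\<exists>us s. ws = us @ [s] @ rev us \<and> reduced_word W S (us @ [s] @ rev us)"
  then obtain us s where ws: "ws = us @ [s] @ rev us" and r: "reduced_word W S ws" by blast
  have S: "us \<in> lists S" "s \<in> S" using reduced_word_lists[OF r] ws by auto
  show "ws \<in> Pal W S" using r val_palindrome_reflection[OF S] unfolding Pal_def ws by simp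
qed

text \<open>For nonempty \<open>v\<close> the middle letter lies in \<open>v\<close>, so
  \<open>u\<close> enters only through its cone. The argument does not cover \<open>v = []\<close>,
  so the empty word is set aside.\<close>

lemma left_quotient_Pref_cone:
  assumes c: "cone u = cone u'"
  shows "left_quotient (Pref W S) u - {[]} \<subseteq> left_quotient (Pref W S) u' - {[]}"
proof
  fix v assume "v \<in> left_quotient (Pref W S) u - {[]}"
  then have v: "u @ v \<in> Pref W S" "v \<noteq> []" by (auto simp: left_quotient_def)
  obtain x s where x: "v = x @ [s]" using v(2) by (cases v rule: rev_cases) auto
  have r: "reduced_word W S ((u @ x) @ [s] @ rev (u @ x))" using v(1) unfolding Pref_iff x by auto
  have xS: "x \<in> lists S" using reduced_word_lists[OF r] by auto
  have "cone (u @ x) = cone (u' @ x)" using c by (simp add: cone_append[OF xS])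
  then have "reduced_word W S ((u' @ x) @ [s] @ rev (u' @ x))" using reduced_palindrome_cone r by blast
  then have "u' @ v \<in> Pref W S" unfolding Pref_iff x by auto
  then show "v \<in> left_quotient (Pref W S) u' - {[]}" using v(2) by (simp add: left_quotient_def)
qed

lemma finite_left_quotients_Pref: "finite (range (left_quotient (Pref W S)))"
proof -
  let ?Q = "left_quotient (Pref W S)"
  let ?R = "{u. reduced_word W S u}"
  define G where "G C = ?Q (SOME u. reduced_word W S u \<and> cone u = C) - {[]}" for C
  have G: "?Q u - {[]} = G (cone u)" if u: "reduced_word W S u" for u
  proof -
    let ?v = "SOME v. reduced_word W S v \<and> cone v = cone u"
    have "cone ?v = cone u" using someI[of "\<lambda>v. reduced_word W S v \<and> cone v = cone u" u] u by simp
    then show ?thesis unfolding G_def using left_quotient_Pref_cone[of u ?v] left_quotient_Pref_cone[of ?v u] by auto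
  qed
  \<comment> \<open>A cone type admits at most two quotients, without and with \<open>[]\<close>; a
    word that is not reduced has the empty quotient.\<close>
  have "range ?Q \<subseteq> insert {} (G ` cone ` ?R \<union> (insert [] \<circ> G) ` cone ` ?R)"
  proof
    fix X assume "X \<in> range ?Q"
    then obtain u where X: "X = ?Q u" by blast
    show "X \<in> insert {} (G ` cone ` ?R \<union> (insert [] \<circ> G) ` cone ` ?R)"
    proof (cases "reduced_word W S u")
      case True
      have "X = G (cone u) \<or> X = insert [] (G (cone u))" using G[OF True] X by blast
      then show ?thesis using True by auto
    next
      case False
      have "X = {}"
        using False reduced_word_append(1)[of u] by (auto simp: X left_quotient_def Pref_def)
      then show ?thesis by simp
    qed
  qed
  then show ?thesis by (rule finite_subset) (simp add: finite_cones)
qed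

lemma Pref_lists: "Pref W S \<subseteq> lists S"
  by (auto simp: Pref_def reduced_word_def)

lemma Pal_eq: "Pal W S = {us @ [s] @ rev us | us s. us @ [s] @ rev us \<in> lists S \<and> us @ [s] \<in> Pref W S}"
proof (intro equalityI subsetI)
  fix ws assume "ws \<in> Pal W S"
  then obtain us s where ws: "ws = us @ [s] @ rev us" "reduced_word W S (us @ [s] @ rev us)"
    unfolding Pal_iff by blast
  then show "ws \<in> {us @ [s] @ rev us | us s. us @ [s] @ rev us \<in> lists S \<and> us @ [s] \<in> Pref W S}"
    using reduced_word_lists[OF ws(2)] Pref_iff[of "us @ [s]"] by blast
next
  fix ws assume "ws \<in> {us @ [s] @ rev us | us s. us @ [s] @ rev us \<in> lists S \<and> us @ [s] \<in> Pref W S}"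
  then obtain us s where ws: "ws = us @ [s] @ rev us" "us @ [s] \<in> Pref W S" by blast
  then show "ws \<in> Pal W S" unfolding Pref_iff Pal_iff by auto
qed

section \<open>Poincare series\<close>

lemma poincare_series_reduced:
  assumes "\<And>ws. ws \<in> B \<Longrightarrow> reduced_word W S ws"
  shows "poincare_series W S B = Abs_fps (\<lambda>n. of_nat (card {ws \<in> B. length ws = n}))"
proof -
  have "{ws \<in> B. len (val ws) = n} = {ws \<in> B. length ws = n}" for n
    using assms by (auto simp: reduced_word_def)
  then show ?thesis by (simp add: poincare_series_def)
qed

lemma poincare_series_Pref:
  "poincare_series W S (Pref W S) = Abs_fps (\<lambda>n. of_nat (card {ws \<in> Pref W S. length ws = n}))"
  by (rule poincare_series_reduced) (simp add: Pref_def)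

lemma poincare_series_Pal: "poincare_series W S (Pal W S) = Abs_fps (\<lambda>n. of_nat (pal W S n))"
  unfolding pal_def by (rule poincare_series_reduced) (simp add: Pal_def)

lemma card_Pref_0: "card {ws \<in> Pref W S. length ws = 0} = 0"
proof -
  have "{ws \<in> Pref W S. length ws = 0} = {}" by (auto simp: Pref_iff)
  then show ?thesis by simp
qed

text \<open>Mirroring all letters but the last is a bijection that turns \<open>us @ [s]\<close>
  into \<open>us @ [s] @ rev us\<close>.\<close>

lemma card_Pref_Suc: "card {ws \<in> Pref W S. length ws = Suc k} = pal W S (2 * k + 1)"
proof -
  let ?A = "{ws \<in> Pref W S. length ws = Suc k}" and ?B = "{ws \<in> Pal W S. length ws = 2 * k + 1}"
  have "bij_betw (\<lambda>ws. ws @ rev (butlast ws)) ?A ?B"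
  proof (rule bij_betw_imageI)
    show "inj_on (\<lambda>ws. ws @ rev (butlast ws)) ?A" by (rule inj_onI) simp
    show "(\<lambda>ws. ws @ rev (butlast ws)) ` ?A = ?B"
    proof (intro equalityI subsetI)
      fix xs assume "xs \<in> (\<lambda>ws. ws @ rev (butlast ws)) ` ?A"
      then obtain ws where ws: "ws \<in> Pref W S" "length ws = Suc k" "xs = ws @ rev (butlast ws)" by auto
      then obtain us s where us: "ws = us @ [s]" "reduced_word W S (us @ [s] @ rev us)"
        unfolding Pref_iff by blast
      then have "xs = us @ [s] @ rev us" using ws by simp
      then show "xs \<in> ?B" using us ws Pal_iff[of xs] by auto
    next
      fix xs assume xs: "xs \<in> ?B"
      then obtain us s where us: "xs = us @ [s] @ rev us" "reduced_word W S (us @ [s] @ rev us)"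
        by (auto simp: Pal_iff)
      then have "us @ [s] \<in> ?A" using xs by (auto simp: Pref_iff)
      then show "xs \<in> (\<lambda>ws. ws @ rev (butlast ws)) ` ?A" using us by (intro image_eqI[of _ _ "us @ [s]"]) auto
    qed
  qed
  then show ?thesis unfolding pal_def by (rule bij_betw_same_card)
qed

lemma pal_even: "even n \<Longrightarrow> pal W S n = 0"
proof -
  assume n: "even n"
  have e: "{ws \<in> Pal W S. length ws = n} = {}" using n by (auto simp: Pal_iff)
  show ?thesis unfolding pal_def e by simp
qed

text \<open>A word of \<open>Pref\<close> with \<open>k + 1\<close> letters corresponds to a
  palindrome with \<open>2 * k + 1\<close> letters; the factor \<open>fps_X\<close> is the shift by
  one, as \<open>Pref\<close> does not contain the empty word.\<close>

lemma poincare_series_Pref_eq: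
  "poincare_series W S (Pref W S) = fps_X * Abs_fps (\<lambda>k. of_nat (pal W S (2 * k + 1)))"
proof (rule fps_ext)
  show "fps_nth (poincare_series W S (Pref W S)) n =
      fps_nth (fps_X * Abs_fps (\<lambda>k. of_nat (pal W S (2 * k + 1)))) n" for n
    using card_Pref_0 card_Pref_Suc[of "n - 1"] by (cases n) (auto simp: poincare_series_Pref)
qed

text \<open>Length \<open>n\<close> in \<open>Pref\<close> becomes \<open>2 * n - 1\<close> in
  \<open>Pal\<close>; the factor \<open>fps_X\<close> on the left restores the exponent
  \<open>2 * n\<close> without a division. Odd exponents vanish on both sides, as words in
  \<open>Pal\<close> have odd length.\<close>

lemma poincare_series_Pal_eq:
  "fps_X * poincare_series W S (Pal W S) = fps_compose (poincare_series W S (Pref W S)) (fps_X ^ 2)"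
proof (rule fps_ext)
  fix n
  show "fps_nth (fps_X * poincare_series W S (Pal W S)) n =
      fps_nth (fps_compose (poincare_series W S (Pref W S)) (fps_X ^ 2)) n"
  proof (cases n)
    case 0
    then show ?thesis using card_Pref_0 by (simp add: poincare_series_Pref fps_nth_compose_X_power)
  next
    case (Suc k)
    show ?thesis
    proof (cases "even k")
      case True
      then show ?thesis by (simp add: Suc poincare_series_Pref poincare_series_Pal fps_nth_compose_X_power pal_even)
    next
      case False
      then obtain j where "k = 2 * j + 1" by (auto elim: oddE)
      then show ?thesis
        using card_Pref_Suc[of j] by (simp add: Suc poincare_series_Pref poincare_series_Pal fps_nth_compose_X_power)
    qed
  qed
qed

end

lemma coxeter_systemE:
  fixes W :: "('a, 'b) monoid_scheme"
  assumes "coxeter_system W S" "finite S"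
  obtains m where "coxeter W S m"
proof -
  obtain m where "group W" "S \<subseteq> carrier W" "generate W S = carrier W" "coxeter_matrix S m"
    "\<forall>u\<in>lists S. \<forall>v\<in>lists S. word_prod W u = word_prod W v \<longleftrightarrow> coxeter_cong S m u v"
    using assms(1) unfolding coxeter_system_def by blast
  then have "coxeter W S m"
    using assms(2) by (intro coxeter.intro coxeter_axioms.intro) auto
  then show thesis by (rule that)
qed

theorem theorem1p1:
  fixes W :: "('a, 'b) monoid_scheme" and S :: "'a set"
  assumes "coxeter_system W S" and "finite S"
  shows
    "Pref W S \<subseteq> lists S \<and> regular_language S (Pref W S) \<and>
     Pal W S = {us @ [s] @ rev us | us s. us @ [s] @ rev us \<in> lists S \<and> us @ [s] \<in> Pref W S} \<and>
     poincare_series W S (Pref W S)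
       = fps_X * Abs_fps (\<lambda>k. of_nat (pal W S (2 * k + 1))) \<and>
     rational_fps (poincare_series W S (Pref W S)) \<and>
     fps_X * poincare_series W S (Pal W S)
       = fps_compose (poincare_series W S (Pref W S)) (fps_X ^ 2) \<and>
     rational_fps (poincare_series W S (Pal W S))"
proof -
  obtain m where "coxeter W S m" using coxeter_systemE[OF assms] .
  then interpret coxeter W S m .
  have reg: "regular_language S (Pref W S)"
    by (rule regular_if_finite_left_quotients[OF Pref_lists finite_left_quotients_Pref])
  have rat: "rational_fps (poincare_series W S (Pref W S))"
    unfolding poincare_series_Pref by (rule rational_if_regular[OF assms(2) reg])
  have "rational_fps (poincare_series W S (Pal W S))"
    by (rule rational_if_X_times_eq_compose_square[OF rat poincare_series_Pal_eq])
  then show ?thesis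
    using Pref_lists reg Pal_eq poincare_series_Pref_eq rat poincare_series_Pal_eq by blast
qed
end
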